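(* Let $n\geq 1$ and let $S$ be a sphere in $\mathbb{R}^{n}$ with center $\gamma=(\gamma_{1},\ldots,\gamma_{n})\in\mathbb{R}^{n}$ such that $S\cap\mathbb{Q}^{n}\neq\emptyset$, and fix $b\in S\cap\mathbb{Q}^{n}$. Let $\Omega$ be the algebraic closure of $\mathbb{Q}(\gamma_{1},\ldots,\gamma_{n})$ in $\mathbb{C}$ and $\Gamma$ the group of $\mathbb{Q}$-automorphisms of $\Omega$. For $\sigma\in\Gamma$, write $\sigma_{\ast}(x_{1},\ldots,x_{n})=(\sigma(x_{1}),\ldots,\sigma(x_{n}))$ for $(x_i)\in\Omega^{n}$. For $a\in\mathbb{R}^{n}$ set $S_{a}=\{x\in\mathbb{R}^{n}:|x-a|=|b-a|\}$ and $\Lambda_{a}=\{x\in\mathbb{R}^{n}:\langle a,x-b\rangle=0\}$. Then \[ \operatorname{Cl}(S\cap\mathbb{Q}^{n})=\bigcap_{\sigma\in\Gamma}\bigl(S_{\Re\sigma_{\ast}(\gamma)}\cap\Lambda_{\Im\sigma_{\ast}(\gamma)}\bigr). \]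
   Context: $\operatorname{Cl}$ is the closure in the Euclidean topology of $\mathbb{R}^{n}$; $|\cdot|$ and $\langle\cdot,\cdot\rangle$ are the standard Euclidean norm and inner product on $\mathbb{R}^{n}$. For $x=(x_i)\in\mathbb{C}^{n}$, $\Re x=(\Re x_i)_i$ and $\Im x=(\Im x_i)_i$. Note $\gamma\in\Omega^n$, so $\sigma_\ast(\gamma)\in\Omega^n\subset\mathbb{C}^n$. $S_a$ is the sphere through $b$ with center $a$; $\Lambda_a$ is the hyperplane through $b$ with normal $a$ if $a\ne 0$ and $\Lambda_0=\mathbb{R}^n$. *)

theory Defs
  imports "HOL-Analysis.Analysis" "HOL-Algebra.Generated_Fields" "HOL-Algebra.Algebraic_Closure_Type"
begin

no_notation fps_nth (infixl \<open>$\<close> 75)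

abbreviation C_ring :: "complex ring" where
  "C_ring \<equiv> ring_of_type_algebra"

definition rational_points :: "(real ^ 'n) set" where
  "rational_points = {x. \<forall>i. x $ i \<in> \<rat>}"

definition of_real_vec :: "real ^ 'n \<Rightarrow> complex ^ 'n" where
  "of_real_vec x = (\<chi> i. complex_of_real (x $ i))"

definition Re_vec :: "complex ^ 'n \<Rightarrow> real ^ 'n" where
  "Re_vec z = (\<chi> i. Re (z $ i))"

definition Im_vec :: "complex ^ 'n \<Rightarrow> real ^ 'n" where
  "Im_vec z = (\<chi> i. Im (z $ i))"

text \<open>
  A subfield of the complex numbers contains all rationals, so the subfield generated by the
  coordinates of \<open>\<gamma>\<close> is the field extension of the rationals generated by them.
\<close>

definition coord_field :: "real ^ 'n \<Rightarrow> complex set" where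
  "coord_field \<gamma> = generate_field C_ring (range (($) (of_real_vec \<gamma>)))"

definition Omega :: "real ^ 'n \<Rightarrow> complex set" where
  "Omega \<gamma> = {z \<in> carrier C_ring. ring.algebraic C_ring (coord_field \<gamma>) z}"

text \<open>
  Automorphisms are represented by functions on the whole type that are \<open>undefined\<close> outside
  the field, so that each automorphism occurs exactly once.
\<close>

definition rat_automorphisms :: "complex set \<Rightarrow> (complex \<Rightarrow> complex) set" where
  "rat_automorphisms K =
     {\<sigma> \<in> ring_iso (C_ring\<lparr>carrier := K\<rparr>) (C_ring\<lparr>carrier := K\<rparr>) \<inter> extensional K.
        \<forall>q\<in>\<rat>. \<sigma> q = q}"

definition apply_coords :: "('a \<Rightarrow> 'b) \<Rightarrow> 'a ^ 'n \<Rightarrow> 'b ^ 'n" where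
  "apply_coords \<sigma> x = (\<chi> i. \<sigma> (x $ i))"

definition sphere_through :: "real ^ 'n \<Rightarrow> real ^ 'n \<Rightarrow> (real ^ 'n) set" where
  "sphere_through b a = {x. norm (x - a) = norm (b - a)}"

text \<open>For \<open>a = 0\<close> this is the whole space.\<close>

definition hyperplane_through :: "real ^ 'n \<Rightarrow> real ^ 'n \<Rightarrow> (real ^ 'n) set" where
  "hyperplane_through b a = {x. a \<bullet> (x - b) = 0}"

end

(*
  Put u = x - b and delta = gamma - b. A point x lies on all the spheres and hyperplanes iff
  sum_i u_i sigma(delta_i) = |u|^2 / 2 for every automorphism sigma of Omega. For rational x the
  single equation for sigma = id implies all others, and the right-hand side is closed.

  Conversely, since Q is the fixed field of the automorphism group, an argument in the style of
  Artin shows that a real solution u of these equations lies in the real span of the Q-subspace L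
  of rational vectors w with <delta, w> rational, which is dense in its real span. The line
  through b in direction w in L meets the sphere again in a rational point, and this second
  intersection depends continuously on w near u, where it takes the value x.

  That Q is the fixed field: a conjugate pair z, z' (for transcendental z take z' = -z) starts an
  isomorphism between subrings of Omega, which is enlarged by Zorn's lemma. To make domain and
  range exhaust Omega simultaneously, only isomorphisms are admitted whose domain and range are
  contained in the same algebraically closed subfields.
*)
theory Submission
  imports Defs
begin

hide_const (open) up_ring.coeff up_ring.monom module.smult Polynomials.degree Polynomials.lead_coeff

section \<open>Isomorphisms between subrings\<close>

text \<open>The graph of an isomorphism between two subrings. Closure under subtraction turns the
  condition at zero into single-valuedness and injectivity, and the relational form treats both
  directions alike.\<close>

definition partial_iso :: "(complex \<times> complex) set \<Rightarrow> bool" where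
  "partial_iso G \<longleftrightarrow> (1, 1) \<in> G \<and>
     (\<forall>a b c d. (a, b) \<in> G \<longrightarrow> (c, d) \<in> G \<longrightarrow> (a - c, b - d) \<in> G \<and> (a * c, b * d) \<in> G) \<and>
     (\<forall>a b. (a, b) \<in> G \<longrightarrow> (a = 0 \<longleftrightarrow> b = 0))"

definition coeffs_rel :: "('a::zero \<times> 'b::zero) set \<Rightarrow> 'a poly \<Rightarrow> 'b poly \<Rightarrow> bool" where
  "coeffs_rel G p q \<longleftrightarrow> (\<forall>i. (coeff p i, coeff q i) \<in> G)"

text \<open>The graph of the intended extension of \<open>G\<close> by \<open>x \<mapsto> y\<close>,
  kept as a relation so that it can be formed before it is known to be well defined.\<close>

definition adjoin_pair :: "(complex \<times> complex) set \<Rightarrow> complex \<Rightarrow> complex \<Rightarrow> (complex \<times> complex) set" where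
  "adjoin_pair G x y = {(poly p x, poly q y) |p q. coeffs_rel G p q}"

context
  fixes G assumes G: "partial_iso G"
begin

section \<open>Ring operations on related pairs\<close>

lemma partial_iso_one: "(1, 1) \<in> G"
  using G by (simp add: partial_iso_def)

lemma partial_iso_diff: "(a, b) \<in> G \<Longrightarrow> (c, d) \<in> G \<Longrightarrow> (a - c, b - d) \<in> G"
  using G by (simp add: partial_iso_def)

lemma partial_iso_mult: "(a, b) \<in> G \<Longrightarrow> (c, d) \<in> G \<Longrightarrow> (a * c, b * d) \<in> G"
  using G by (simp add: partial_iso_def)

lemma partial_iso_zero_iff: "(a, b) \<in> G \<Longrightarrow> a = 0 \<longleftrightarrow> b = 0"
  using G by (simp add: partial_iso_def)

lemma partial_iso_zero: "(0, 0) \<in> G"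
  using partial_iso_diff[OF partial_iso_one partial_iso_one] by simp

lemma partial_iso_add: "(a, b) \<in> G \<Longrightarrow> (c, d) \<in> G \<Longrightarrow> (a + c, b + d) \<in> G"
  using partial_iso_diff[of a b "0 - c" "0 - d"] partial_iso_diff[OF partial_iso_zero] by simp

lemma partial_iso_sum: "(\<And>i. i \<in> I \<Longrightarrow> (f i, g i) \<in> G) \<Longrightarrow> (sum f I, sum g I) \<in> G"
  by (induction I rule: infinite_finite_induct) (auto intro: partial_iso_zero partial_iso_add)

lemma partial_iso_power: "(a, b) \<in> G \<Longrightarrow> (a ^ n, b ^ n) \<in> G"
  by (induction n) (auto intro: partial_iso_one partial_iso_mult)

section \<open>Polynomials with related coefficients\<close>

lemma coeffs_rel_0: "coeffs_rel G 0 0"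
  by (simp add: coeffs_rel_def partial_iso_zero)

lemma coeffs_rel_pCons:
  "(a, b) \<in> G \<Longrightarrow> coeffs_rel G p q \<Longrightarrow> coeffs_rel G (pCons a p) (pCons b q)"
  by (auto simp: coeffs_rel_def coeff_pCons split: nat.splits)

lemma coeffs_rel_add: "coeffs_rel G p q \<Longrightarrow> coeffs_rel G p' q' \<Longrightarrow> coeffs_rel G (p + p') (q + q')"
  by (simp add: coeffs_rel_def partial_iso_add)

lemma coeffs_rel_diff: "coeffs_rel G p q \<Longrightarrow> coeffs_rel G p' q' \<Longrightarrow> coeffs_rel G (p - p') (q - q')"
  by (simp add: coeffs_rel_def partial_iso_diff)

lemma coeffs_rel_mult: "coeffs_rel G p q \<Longrightarrow> coeffs_rel G p' q' \<Longrightarrow> coeffs_rel G (p * p') (q * q')"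
  by (auto simp: coeffs_rel_def coeff_mult intro!: partial_iso_sum partial_iso_mult)

lemma coeffs_rel_smult: "(a, b) \<in> G \<Longrightarrow> coeffs_rel G p q \<Longrightarrow> coeffs_rel G (smult a p) (smult b q)"
  by (simp add: coeffs_rel_def partial_iso_mult)

lemma coeffs_rel_monom: "(a, b) \<in> G \<Longrightarrow> coeffs_rel G (monom a n) (monom b n)"
  by (simp add: coeffs_rel_def partial_iso_zero)

lemma coeffs_rel_zero_iff: "coeffs_rel G p q \<Longrightarrow> p = 0 \<longleftrightarrow> q = 0"
  by (metis coeffs_rel_def leading_coeff_0_iff partial_iso_zero_iff coeff_0)

lemma coeffs_rel_degree: "coeffs_rel G p q \<Longrightarrow> degree p = degree q"
  unfolding degree_def coeffs_rel_def using partial_iso_zero_iff by meson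

lemma coeffs_rel_lead_coeff:
  "coeffs_rel G p q \<Longrightarrow> (lead_coeff p, lead_coeff q) \<in> G"
  using coeffs_rel_degree[of p q] by (simp add: coeffs_rel_def)

text \<open>Leading coefficients need not be invertible in the domain of \<open>G\<close>, hence the
  powers of \<open>lead_coeff p\<close>. Both divisions perform the same steps, which keeps the
  quotients and remainders related.\<close>

lemma coeffs_rel_pseudo_divide:
  assumes p: "coeffs_rel G p p'" "p \<noteq> 0"
    and "coeffs_rel G f f'"
  obtains k q q' r r' where "coeffs_rel G q q'" "coeffs_rel G r r'"
    "smult (lead_coeff p ^ k) f = q * p + r" "smult (lead_coeff p' ^ k) f' = q' * p' + r'"
    "r = 0 \<or> degree r < degree p"
proof -
  have "\<exists>k q q' r r'. coeffs_rel G q q' \<and> coeffs_rel G r r' \<and>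
      smult (lead_coeff p ^ k) f = q * p + r \<and> smult (lead_coeff p' ^ k) f' = q' * p' + r' \<and>
      (r = 0 \<or> degree r < degree p)"
    if "coeffs_rel G f f'" "f = 0 \<or> degree f < n" for n f f'
    using that
  proof (induction n arbitrary: f f')
    case 0
    then have "f = 0" "f' = 0" using coeffs_rel_zero_iff by auto
    then show ?case
      using coeffs_rel_0 by (intro exI[of _ 0]) auto
  next
    case (Suc n)
    consider "f = 0 \<or> degree f < n" | "degree f = n" "degree f < degree p"
      | "degree f = n" "degree p \<le> degree f" using Suc.prems(2) by linarith
    then show ?case
    proof cases
      case 1
      then show ?thesis using Suc by blast
    next
      case 2
      then show ?thesis
        using Suc.prems coeffs_rel_0
        by (intro exI[of _ 0] exI[of _ f] exI[of _ f']) auto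
    next
      case 3
      \<comment> \<open>Subtracting \<open>m * p\<close> from \<open>smult (lead_coeff p) f\<close>
        cancels the leading terms.\<close>
      define m where "m = monom (lead_coeff f) (degree f - degree p)"
      define m' where "m' = monom (lead_coeff f') (degree f - degree p)"
      define f1 where "f1 = smult (lead_coeff p) f - m * p"
      define f1' where "f1' = smult (lead_coeff p') f' - m' * p'"
      have m: "coeffs_rel G m m'"
        unfolding m_def m'_def
        by (intro coeffs_rel_monom coeffs_rel_lead_coeff Suc.prems)
      have f1: "coeffs_rel G f1 f1'"
        unfolding f1_def f1'_def
        by (intro coeffs_rel_diff coeffs_rel_mult coeffs_rel_smult coeffs_rel_lead_coeff m p Suc.prems)
      have "degree f1 \<le> n"
        unfolding f1_def
      proof (rule degree_diff_le)
        show "degree (smult (lead_coeff p) f) \<le> n" using 3 by simp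
        have "degree m \<le> degree f - degree p"
          unfolding m_def by (rule degree_monom_le)
        then show "degree (m * p) \<le> n"
          using degree_mult_le[of m p] 3 by linarith
      qed
      moreover have "coeff f1 n = 0"
        using 3 coeff_monom_mult[of "lead_coeff f" "degree f - degree p" p n] by (simp add: f1_def m_def)
      ultimately have "f1 = 0 \<or> degree f1 < n"
        by (rule eq_zero_or_degree_less)
      from Suc.IH[OF f1 this] obtain k q q' r r' where IH: "coeffs_rel G q q'" "coeffs_rel G r r'"
        "smult (lead_coeff p ^ k) f1 = q * p + r" "smult (lead_coeff p' ^ k) f1' = q' * p' + r'"
        "r = 0 \<or> degree r < degree p" by blast
      have "smult (lead_coeff p ^ Suc k) f = (q + smult (lead_coeff p ^ k) m) * p + r"
        using IH(3) by (simp add: f1_def algebra_simps smult_diff_right smult_add_right)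
      moreover have "smult (lead_coeff p' ^ Suc k) f' = (q' + smult (lead_coeff p' ^ k) m') * p' + r'"
        using IH(4) by (simp add: f1'_def algebra_simps smult_diff_right smult_add_right)
      moreover have "coeffs_rel G (q + smult (lead_coeff p ^ k) m) (q' + smult (lead_coeff p' ^ k) m')"
        by (intro coeffs_rel_add coeffs_rel_smult partial_iso_power coeffs_rel_lead_coeff IH m p)
      ultimately show ?thesis using IH(2,5) by blast
    qed
  qed
  from this[OF assms(3), of "Suc (degree f)"] show ?thesis using that by blast
qed

text \<open>Differences and products of polynomial values come from those of the polynomials, so
  only the condition at zero remains, and this is the assumption.\<close>

lemma partial_iso_adjoin_pair:
  assumes "\<And>p q. coeffs_rel G p q \<Longrightarrow> poly p x = 0 \<longleftrightarrow> poly q y = 0"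
  shows "partial_iso (adjoin_pair G x y)"
  unfolding partial_iso_def
proof (intro conjI allI impI)
  show "(1, 1) \<in> adjoin_pair G x y"
    using coeffs_rel_pCons[OF partial_iso_one coeffs_rel_0]
    unfolding adjoin_pair_def by (force intro: exI[of _ "[:1:]"])
next
  fix a b c d assume "(a, b) \<in> adjoin_pair G x y" "(c, d) \<in> adjoin_pair G x y"
  then obtain p q p' q' where *: "coeffs_rel G p q" "a = poly p x" "b = poly q y"
    "coeffs_rel G p' q'" "c = poly p' x" "d = poly q' y"
    unfolding adjoin_pair_def by blast
  show "(a - c, b - d) \<in> adjoin_pair G x y"
    using coeffs_rel_diff[OF *(1,4)] unfolding adjoin_pair_def * by (metis (mono_tags, lifting) mem_Collect_eq poly_diff)
  show "(a * c, b * d) \<in> adjoin_pair G x y"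
    using coeffs_rel_mult[OF *(1,4)] unfolding adjoin_pair_def * by (metis (mono_tags, lifting) mem_Collect_eq poly_mult)
next
  fix a b assume "(a, b) \<in> adjoin_pair G x y"
  then show "a = 0 \<longleftrightarrow> b = 0"
    unfolding adjoin_pair_def by (auto simp: assms)
qed

lemma subset_adjoin_pair: "G \<subseteq> adjoin_pair G x y"
proof
  fix z assume "z \<in> G"
  then have "coeffs_rel G [:fst z:] [:snd z:]"
    by (intro coeffs_rel_pCons coeffs_rel_0) simp
  then show "z \<in> adjoin_pair G x y"
    unfolding adjoin_pair_def by (cases z) force
qed

lemma mem_adjoin_pair: "(x, y) \<in> adjoin_pair G x y"
proof -
  have "coeffs_rel G [:0, 1:] [:0, 1:]"
    by (intro coeffs_rel_pCons coeffs_rel_0 partial_iso_zero partial_iso_one)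
  then show ?thesis
    unfolding adjoin_pair_def by force
qed

text \<open>Irreducibility of a minimal polynomial of \<open>x\<close> passes to its image: a proper factor of
  \<open>p'\<close> vanishing at \<open>y\<close> would pull back to a proper factor of \<open>p\<close>.\<close>

lemma poly_zero_iff_minimal:
  assumes p: "coeffs_rel G p p'" "p \<noteq> 0" "poly p x = 0"
    and min: "\<And>f f'. coeffs_rel G f f' \<Longrightarrow> f \<noteq> 0 \<Longrightarrow> poly f x = 0 \<Longrightarrow> degree p \<le> degree f"
    and y: "poly p' y = 0" and f: "coeffs_rel G f f'"
  shows "poly f x = 0 \<longleftrightarrow> poly f' y = 0"
proof -
  have p': "p' \<noteq> 0" using coeffs_rel_zero_iff[OF p(1)] p(2) by simp
  \<comment> \<open>\<open>n\<close> will be the least degree on the side of \<open>y\<close>, where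
    \<open>p'\<close> is not yet known to be minimal; the aim is
    \<open>degree p \<le> n\<close>.\<close>
  define P where "P = (\<lambda>n. \<exists>g g'. coeffs_rel G g g' \<and> g \<noteq> 0 \<and> poly g' y = 0 \<and> degree g = n)"
  have "P (degree p)" unfolding P_def using p y by blast
  define n where "n = (LEAST n. P n)"
  have "P n" unfolding n_def using \<open>P (degree p)\<close> by (rule LeastI)
  then obtain g g' where g: "coeffs_rel G g g'" "g \<noteq> 0" "poly g' y = 0" "degree g = n"
    unfolding P_def by blast
  have n_le: "n \<le> degree h" if "coeffs_rel G h h'" "h \<noteq> 0" "poly h' y = 0" for h h'
    unfolding n_def using that by (intro Least_le) (auto simp: P_def)
  have g': "g' \<noteq> 0" using coeffs_rel_zero_iff[OF g(1)] g(2) by simp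
  have deg: "degree p \<le> n"
  proof -
    from coeffs_rel_pseudo_divide[OF g(1,2) p(1)] obtain k q q' r r' where
      *: "coeffs_rel G q q'" "coeffs_rel G r r'"
      "smult (lead_coeff g ^ k) p = q * g + r" "smult (lead_coeff g' ^ k) p' = q' * g' + r'"
      "r = 0 \<or> degree r < degree g" by metis
    have "poly r' y = 0"
      using arg_cong[OF *(4), of "\<lambda>p. poly p y"] y g(3) by simp
    then have "r = 0" using n_le[OF *(2)] *(5) g(4) by fastforce
    then have qg: "smult (lead_coeff g ^ k) p = q * g" using *(3) by simp
    then have "q \<noteq> 0" using p(2) g(2) by auto
    have "degree p = degree q + degree g"
      using arg_cong[OF qg, of degree] \<open>q \<noteq> 0\<close> g(2) by (simp add: degree_mult_eq)
    moreover have "poly q x = 0 \<or> poly g x = 0"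
      using arg_cong[OF qg, of "\<lambda>p. poly p x"] p(3) by simp
    \<comment> \<open>A positive degree of \<open>g\<close> makes \<open>degree q\<close> smaller
      than \<open>degree p\<close>, so minimality of \<open>p\<close> leaves \<open>g\<close> as the
      factor that vanishes at \<open>x\<close>.\<close>
    moreover have "degree g \<noteq> 0"
    proof
      assume "degree g = 0"
      then have "degree g' = 0" using coeffs_rel_degree[OF g(1)] by simp
      then obtain c where "g' = [:c:]" by (rule degree_eq_zeroE)
      then show False using g(3) g' by simp
    qed
    ultimately show ?thesis
      using min[OF *(1) \<open>q \<noteq> 0\<close>] min[OF g(1,2)] g(4) by auto
  qed
  from coeffs_rel_pseudo_divide[OF p(1,2) f] obtain k q q' r r' where
    *: "coeffs_rel G q q'" "coeffs_rel G r r'"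
    "smult (lead_coeff p ^ k) f = q * p + r" "smult (lead_coeff p' ^ k) f' = q' * p' + r'"
    "r = 0 \<or> degree r < degree p" by metis
  have rx: "lead_coeff p ^ k * poly f x = poly r x"
    using arg_cong[OF *(3), of "\<lambda>p. poly p x"] p(3) by simp
  have ry: "lead_coeff p' ^ k * poly f' y = poly r' y"
    using arg_cong[OF *(4), of "\<lambda>p. poly p y"] y by simp
  show ?thesis
  proof (cases "r = 0")
    case True
    then have "r' = 0" using coeffs_rel_zero_iff[OF *(2)] by simp
    then show ?thesis using rx ry True p(2) p' by simp
  next
    case False
    \<comment> \<open>The nonzero remainder lies below the least degree on both sides.\<close>
    then have "poly r x \<noteq> 0" "poly r' y \<noteq> 0"
      using *(5) min[OF *(2)] n_le[OF *(2)] deg by auto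
    then show ?thesis using rx ry p(2) p' by auto
  qed
qed

end

section \<open>Extension to automorphisms\<close>

text \<open>These are the algebraically closed subfields of the complex numbers: quotients are roots
  of linear polynomials.\<close>

definition root_closed_ring :: "complex set \<Rightarrow> bool" where
  "root_closed_ring M \<longleftrightarrow> 1 \<in> M \<and> (\<forall>a\<in>M. \<forall>b\<in>M. a - b \<in> M \<and> a * b \<in> M) \<and>
     (\<forall>p x. p \<noteq> 0 \<longrightarrow> (\<forall>i. coeff p i \<in> M) \<longrightarrow> poly p x = 0 \<longrightarrow> x \<in> M)"

text \<open>Domain and range have the same algebraic closure within the complex numbers. An
  algebraically closed field of infinite transcendence degree embeds properly into itself; this
  condition prevents a maximal partial isomorphism from being such an embedding.\<close>

definition balanced :: "(complex \<times> complex) set \<Rightarrow> bool" where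
  "balanced G \<longleftrightarrow> (\<forall>M. root_closed_ring M \<longrightarrow> (Domain G \<subseteq> M \<longleftrightarrow> Range G \<subseteq> M))"

section \<open>Closure properties of algebraically closed subfields\<close>

lemma root_closed_ring_diff: "root_closed_ring M \<Longrightarrow> a \<in> M \<Longrightarrow> b \<in> M \<Longrightarrow> a - b \<in> M"
  and root_closed_ring_mult: "root_closed_ring M \<Longrightarrow> a \<in> M \<Longrightarrow> b \<in> M \<Longrightarrow> a * b \<in> M"
  and root_closed_ring_one: "root_closed_ring M \<Longrightarrow> 1 \<in> M"
  and root_closed_ringD:
    "root_closed_ring M \<Longrightarrow> p \<noteq> 0 \<Longrightarrow> (\<And>i. coeff p i \<in> M) \<Longrightarrow> poly p x = 0 \<Longrightarrow> x \<in> M"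
  unfolding root_closed_ring_def by blast+

lemma root_closed_ring_zero: "root_closed_ring M \<Longrightarrow> 0 \<in> M"
  using root_closed_ring_diff[of M 1 1] by (simp add: root_closed_ring_one)

lemma root_closed_ring_uminus: "root_closed_ring M \<Longrightarrow> a \<in> M \<Longrightarrow> - a \<in> M"
  using root_closed_ring_diff[of M 0 a] by (simp add: root_closed_ring_zero)

lemma root_closed_ring_add: "root_closed_ring M \<Longrightarrow> a \<in> M \<Longrightarrow> b \<in> M \<Longrightarrow> a + b \<in> M"
  using root_closed_ring_diff[of M a "- b"] by (simp add: root_closed_ring_uminus)

lemma root_closed_ring_sum:
  "root_closed_ring M \<Longrightarrow> (\<And>i. i \<in> I \<Longrightarrow> f i \<in> M) \<Longrightarrow> sum f I \<in> M"
  by (induction I rule: infinite_finite_induct) (auto intro: root_closed_ring_zero root_closed_ring_add)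

lemma root_closed_ring_poly:
  assumes "root_closed_ring M" "\<And>i. coeff p i \<in> M" "x \<in> M"
  shows "poly p x \<in> M"
  using assms(2)
proof (induction p)
  case 0
  then show ?case using root_closed_ring_zero[OF assms(1)] by simp
next
  case (pCons a p)
  have "a \<in> M" "\<And>i. coeff p i \<in> M"
    using pCons.prems[of 0] pCons.prems[of "Suc i" for i] by simp_all
  then show ?case
    using pCons.IH assms(1,3) by (simp add: root_closed_ring_add root_closed_ring_mult)
qed

text \<open>For \<open>b \<noteq> 0\<close> the quotient is the root of the linear polynomial
  \<open>b X - a\<close>; for \<open>b = 0\<close> it is \<open>0\<close> by convention.\<close>

lemma root_closed_ring_divide:
  assumes "root_closed_ring M" "a \<in> M" "b \<in> M"
  shows "a / b \<in> M"
proof (cases "b = 0")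
  case True
  then show ?thesis using root_closed_ring_zero[OF assms(1)] by simp
next
  case False
  show ?thesis
    by (rule root_closed_ringD[OF assms(1), of "[:- a, b:]"])
      (use False assms in \<open>auto simp: coeff_pCons root_closed_ring_zero root_closed_ring_uminus split: nat.splits\<close>)
qed

lemma Rats_subset_root_closed_ring:
  assumes "root_closed_ring M"
  shows "\<rat> \<subseteq> M"
proof
  fix q :: complex assume "q \<in> \<rat>"
  have nat: "of_nat n \<in> M" for n
    by (induction n) (use assms root_closed_ring_zero root_closed_ring_one root_closed_ring_add in auto)
  have int: "of_int k \<in> M" for k
    using nat root_closed_ring_uminus[OF assms] by (cases k rule: int_cases2) simp_all
  from \<open>q \<in> \<rat>\<close> show "q \<in> M"
    by (elim Rats_cases') (auto intro: root_closed_ring_divide[OF assms] int)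
qed

section \<open>Converses, adjunction and balance\<close>

lemma partial_iso_converse: "partial_iso G \<Longrightarrow> partial_iso (G\<inverse>)"
  unfolding partial_iso_def by blast

lemma adjoin_pair_converse: "(adjoin_pair G x y)\<inverse> = adjoin_pair (G\<inverse>) y x"
  unfolding adjoin_pair_def coeffs_rel_def by blast

lemma balanced_converse: "balanced G \<Longrightarrow> balanced (G\<inverse>)"
  unfolding balanced_def by auto

lemma Domain_adjoin_pair_subset:
  assumes "root_closed_ring M" "Domain G \<subseteq> M" "x \<in> M"
  shows "Domain (adjoin_pair G x y) \<subseteq> M"
  using assms unfolding adjoin_pair_def coeffs_rel_def
  by (auto intro!: root_closed_ring_poly)

lemma Range_adjoin_pair_subset:
  assumes "root_closed_ring M" "Range G \<subseteq> M" "y \<in> M"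
  shows "Range (adjoin_pair G x y) \<subseteq> M"
  using Domain_adjoin_pair_subset[of M "G\<inverse>" y x] assms by (simp flip: adjoin_pair_converse)

text \<open>A root closed ring containing the old domain and \<open>x\<close> contains all
  polynomial values at \<open>x\<close>, and likewise for the range and \<open>y\<close>, so only
  the memberships of \<open>x\<close> and \<open>y\<close> have to be compared.\<close>

lemma balanced_adjoin_pair:
  assumes G: "partial_iso G" "balanced G"
    and xy: "\<And>M. root_closed_ring M \<Longrightarrow> Domain G \<subseteq> M \<Longrightarrow> Range G \<subseteq> M \<Longrightarrow> x \<in> M \<longleftrightarrow> y \<in> M"
  shows "balanced (adjoin_pair G x y)"
  unfolding balanced_def
proof (intro allI impI iffI)
  fix M assume M: "root_closed_ring M" and D: "Domain (adjoin_pair G x y) \<subseteq> M"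
  then have "Domain G \<subseteq> M" "x \<in> M"
    using subset_adjoin_pair[OF G(1), of x y] mem_adjoin_pair[OF G(1), of x y] by blast+
  moreover then have "Range G \<subseteq> M" using G(2) M by (simp add: balanced_def)
  ultimately show "Range (adjoin_pair G x y) \<subseteq> M"
    using xy[OF M] Range_adjoin_pair_subset[OF M] by blast
next
  fix M assume M: "root_closed_ring M" and D: "Range (adjoin_pair G x y) \<subseteq> M"
  then have "Range G \<subseteq> M" "y \<in> M"
    using subset_adjoin_pair[OF G(1), of x y] mem_adjoin_pair[OF G(1), of x y] by blast+
  moreover then have "Domain G \<subseteq> M" using G(2) M by (simp add: balanced_def)
  ultimately show "Domain (adjoin_pair G x y) \<subseteq> M"
    using xy[OF M] Domain_adjoin_pair_subset[OF M] by blast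
qed

text \<open>Replaces the minimal polynomial: over a ring no monic choice need exist, but one of
  least degree does.\<close>

lemma obtain_minimal_coeffs_rel:
  assumes "coeffs_rel G p p'" "p \<noteq> 0" "poly p x = 0"
  obtains q q' where "coeffs_rel G q q'" "q \<noteq> 0" "poly q x = 0"
    "\<And>f f'. coeffs_rel G f f' \<Longrightarrow> f \<noteq> 0 \<Longrightarrow> poly f x = 0 \<Longrightarrow> degree q \<le> degree f"
proof -
  define P where "P = (\<lambda>n. \<exists>g g'. coeffs_rel G g g' \<and> g \<noteq> 0 \<and> poly g x = 0 \<and> degree g = n)"
  have "P (degree p)" unfolding P_def using assms by blast
  then have "P (LEAST n. P n)" by (rule LeastI)
  then obtain q q' where q: "coeffs_rel G q q'" "q \<noteq> 0" "poly q x = 0" "degree q = (LEAST n. P n)"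
    unfolding P_def by blast
  show ?thesis
  proof (rule that[OF q(1-3)])
    fix f f' assume "coeffs_rel G f f'" "f \<noteq> 0" "poly f x = 0"
    then show "degree q \<le> degree f"
      unfolding q(4) by (intro Least_le) (auto simp: P_def)
  qed
qed

lemma degree_pos_of_root:
  assumes "p \<noteq> 0" "poly p x = 0" shows "degree p > 0"
proof (rule ccontr)
  assume "\<not> degree p > 0"
  then obtain c where "p = [:c:]" using degree_eq_zeroE by blast
  then show False using assms by simp
qed

lemma complex_poly_has_root:
  fixes p :: "complex poly" assumes "degree p > 0" shows "\<exists>z. poly p z = 0"
  using assms by (intro fundamental_theorem_of_algebra) (simp add: constant_degree)

text \<open>By the fundamental theorem of algebra the image of a minimal polynomial of
  \<open>x\<close> has a root \<open>y\<close>. The polynomial \<open>q\<close> records that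
  \<open>y\<close> is algebraic over the range, from which balance will follow.\<close>

lemma partial_iso_extend_algebraic:
  assumes G: "partial_iso G" and p: "p \<noteq> 0" "\<And>i. coeff p i \<in> Domain G" "poly p x = 0"
  obtains y q where "partial_iso (adjoin_pair G x y)" "q \<noteq> 0" "\<And>i. coeff q i \<in> Range G" "poly q y = 0"
proof -
  define g where "g a = (SOME b. (a, b) \<in> G)" for a
  have g: "(a, g a) \<in> G" if "a \<in> Domain G" for a
    unfolding g_def using that by (auto intro: someI)
  \<comment> \<open>\<open>map_poly\<close> acts coefficientwise for maps that send zero to
    zero.\<close>
  have "g 0 = 0"
    using g[of 0] partial_iso_zero[OF G] partial_iso_zero_iff[OF G] by blast
  then have "coeffs_rel G p (map_poly g p)"
    using g p(2) by (simp add: coeffs_rel_def coeff_map_poly)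
  from obtain_minimal_coeffs_rel[OF this p(1,3)] obtain q q' where q: "coeffs_rel G q q'" "q \<noteq> 0"
    "poly q x = 0" and min: "\<And>f f'. coeffs_rel G f f' \<Longrightarrow> f \<noteq> 0 \<Longrightarrow> poly f x = 0 \<Longrightarrow> degree q \<le> degree f"
    by metis
  have "degree q' > 0"
    using degree_pos_of_root[OF q(2,3)] coeffs_rel_degree[OF G q(1)] by simp
  then obtain y where y: "poly q' y = 0" using complex_poly_has_root by blast
  have "partial_iso (adjoin_pair G x y)"
    using poly_zero_iff_minimal[OF G q min y] by (rule partial_iso_adjoin_pair[OF G])
  moreover have "q' \<noteq> 0" using coeffs_rel_zero_iff[OF G q(1)] q(2) by simp
  moreover have "coeff q' i \<in> Range G" for i using q(1) by (auto simp: coeffs_rel_def)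
  ultimately show ?thesis using that y by blast
qed

text \<open>A root \<open>x\<close> of a polynomial over the domain can be adjoined together with a
  partner \<open>y\<close> algebraic over the range. Both lie in \<open>K\<close> and balance
  persists, so by maximality \<open>x\<close> is in the domain already.\<close>

lemma maximal_partial_iso_root_closed:
  assumes K: "root_closed_ring K"
    and G: "partial_iso G" "G \<subseteq> K \<times> K" "balanced G"
    and max: "\<And>H. partial_iso H \<Longrightarrow> H \<subseteq> K \<times> K \<Longrightarrow> balanced H \<Longrightarrow> G \<subseteq> H \<Longrightarrow> H = G"
  shows "root_closed_ring (Domain G)"
  unfolding root_closed_ring_def
proof (intro conjI ballI allI impI)
  show "1 \<in> Domain G" using partial_iso_one[OF G(1)] by blast
next
  fix a b assume "a \<in> Domain G" "b \<in> Domain G"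
  then show "a - b \<in> Domain G" "a * b \<in> Domain G"
    using partial_iso_diff[OF G(1)] partial_iso_mult[OF G(1)] by blast+
next
  fix p x assume p: "p \<noteq> 0" "\<forall>i. coeff p i \<in> Domain G" "poly p x = 0"
  from partial_iso_extend_algebraic[OF G(1) p(1) spec[OF p(2)] p(3)] obtain y q
    where y: "partial_iso (adjoin_pair G x y)" "q \<noteq> 0" "\<And>i. coeff q i \<in> Range G" "poly q y = 0"
    by metis
  have x_mem: "x \<in> M" if "root_closed_ring M" "Domain G \<subseteq> M" for M
    using root_closed_ringD[OF that(1) p(1) _ p(3)] p(2) that(2) by blast
  have y_mem: "y \<in> M" if "root_closed_ring M" "Range G \<subseteq> M" for M
    using root_closed_ringD[OF that(1) y(2) _ y(4)] y(3) that(2) by blast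
  have "Domain G \<subseteq> K" "Range G \<subseteq> K" using G(2) by auto
  then have "Domain (adjoin_pair G x y) \<subseteq> K" "Range (adjoin_pair G x y) \<subseteq> K"
    using Domain_adjoin_pair_subset[OF K _ x_mem[OF K]] Range_adjoin_pair_subset[OF K _ y_mem[OF K]]
    by simp_all
  then have "adjoin_pair G x y \<subseteq> K \<times> K" by (auto simp: subset_iff)
  then have "adjoin_pair G x y = G"
    using x_mem y_mem
    by (intro max y balanced_adjoin_pair G subset_adjoin_pair) blast+
  then show "x \<in> Domain G" using mem_adjoin_pair[OF G(1), of x y] by blast
qed

text \<open>Each defining condition involves at most two pairs, and two pairs in the union of a
  chain lie in a common member.\<close>

lemma partial_iso_Union_chain:
  assumes "C \<noteq> {}" "subset.chain A C" "\<And>G. G \<in> C \<Longrightarrow> partial_iso G"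
  shows "partial_iso (\<Union>C)"
proof -
  have two: "\<exists>G\<in>C. s \<in> G \<and> t \<in> G" if "s \<in> \<Union>C" "t \<in> \<Union>C" for s t
  proof -
    from that obtain G H where GH: "G \<in> C" "s \<in> G" "H \<in> C" "t \<in> H" by blast
    then have "G \<subseteq> H \<or> H \<subseteq> G" using assms(2) by (auto simp: subset.chain_def)
    then show ?thesis using GH by blast
  qed
  show ?thesis
    unfolding partial_iso_def
  proof (intro conjI allI impI)
    show "(1, 1) \<in> \<Union>C" using assms(1,3) partial_iso_one by blast
  next
    fix a b c d assume "(a, b) \<in> \<Union>C" "(c, d) \<in> \<Union>C"
    then obtain G where "G \<in> C" "(a, b) \<in> G" "(c, d) \<in> G" using two by blast
    then show "(a - c, b - d) \<in> \<Union>C" "(a * c, b * d) \<in> \<Union>C"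
      using assms(3) partial_iso_diff partial_iso_mult by blast+
  next
    fix a b assume "(a, b) \<in> \<Union>C"
    then show "a = 0 \<longleftrightarrow> b = 0" using assms(3) partial_iso_zero_iff by blast
  qed
qed

text \<open>A maximal balanced partial isomorphism has root closed domain \<open>D\<close> and range \<open>R\<close>; being balanced
  forces \<open>D = R\<close>, so that a further element can be adjoined as a fixed point.\<close>

theorem partial_iso_extends_to_automorphism:
  assumes K: "root_closed_ring K"
    and G0: "partial_iso G0" "G0 \<subseteq> K \<times> K" "balanced G0"
  obtains G where "partial_iso G" "G0 \<subseteq> G" "Domain G = K" "Range G = K"
proof -
  define A where "A = {G. partial_iso G \<and> G \<subseteq> K \<times> K \<and> balanced G \<and> G0 \<subseteq> G}"
  have "\<exists>G\<in>A. \<forall>H\<in>A. G \<subseteq> H \<longrightarrow> H = G"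
  proof (rule subset_Zorn_nonempty)
    show "A \<noteq> {}" using G0 by (auto simp: A_def)
  next
    fix C assume C: "C \<noteq> {}" "subset.chain A C"
    then have "C \<subseteq> A" by (simp add: subset.chain_def)
    then have "partial_iso (\<Union>C)"
      by (intro partial_iso_Union_chain[OF C]) (auto simp: A_def)
    moreover have "balanced (\<Union>C)"
      unfolding balanced_def
    proof (intro allI impI)
      fix M assume "root_closed_ring M"
      then have "Domain G \<subseteq> M \<longleftrightarrow> Range G \<subseteq> M" if "G \<in> C" for G
        using that \<open>C \<subseteq> A\<close> by (auto simp: A_def balanced_def subset_iff)
      then show "Domain (\<Union>C) \<subseteq> M \<longleftrightarrow> Range (\<Union>C) \<subseteq> M"
        unfolding Domain_Union Range_Union UN_subset_iff by blast
    qed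
    ultimately show "\<Union>C \<in> A" using C(1) \<open>C \<subseteq> A\<close> unfolding A_def by blast
  qed
  then obtain G where "G \<in> A" and max_A: "\<And>H. H \<in> A \<Longrightarrow> G \<subseteq> H \<Longrightarrow> H = G" by blast
  then have G: "partial_iso G" "G \<subseteq> K \<times> K" "balanced G" "G0 \<subseteq> G" by (auto simp: A_def)
  have max: "H = G" if "partial_iso H" "H \<subseteq> K \<times> K" "balanced H" "G \<subseteq> H" for H
    using max_A[of H] that G(4) by (auto simp: A_def)
  have D: "root_closed_ring (Domain G)"
    using K G(1-3) max by (rule maximal_partial_iso_root_closed)
  \<comment> \<open>The converse of \<open>G\<close> is maximal too, so the same lemma handles the
    range.\<close>
  have "root_closed_ring (Domain (G\<inverse>))"
  proof (rule maximal_partial_iso_root_closed[OF K])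
    show "partial_iso (G\<inverse>)" "balanced (G\<inverse>)" "G\<inverse> \<subseteq> K \<times> K"
      using G partial_iso_converse balanced_converse by blast+
    fix H assume "partial_iso H" "H \<subseteq> K \<times> K" "balanced H" "G\<inverse> \<subseteq> H"
    then have "H\<inverse> = G"
      by (intro max partial_iso_converse balanced_converse) auto
    then show "H = G\<inverse>" by (metis converse_converse)
  qed
  then have R: "root_closed_ring (Range G)" by simp
  \<comment> \<open>Balance is tested on the domain and on the range themselves.\<close>
  have DR: "Range G = Domain G"
    using G(3) D R unfolding balanced_def by blast
  have "x \<in> Domain G" if "x \<in> K" for x
  proof (rule ccontr)
    assume x: "x \<notin> Domain G"
    \<comment> \<open>Outside \<open>Domain G = Range G\<close> the element \<open>x\<close> is
      transcendental over both; the disjunction covers polynomials on either side of a related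
      pair.\<close>
    have "p = 0" if "coeffs_rel G p q \<or> coeffs_rel G q p" "poly p x = 0" for p q
    proof (rule ccontr)
      assume "p \<noteq> 0"
      moreover have "coeff p i \<in> Domain G" for i
        using that(1) unfolding coeffs_rel_def by (metis DR DomainI RangeI)
      ultimately show False using root_closed_ringD[OF D _ _ that(2)] x by blast
    qed
    then have "poly p x = 0 \<longleftrightarrow> poly q x = 0" if "coeffs_rel G p q" for p q
      using coeffs_rel_zero_iff[OF G(1) that] that by fastforce
    then have "partial_iso (adjoin_pair G x x)"
      by (rule partial_iso_adjoin_pair[OF G(1)])
    moreover have "balanced (adjoin_pair G x x)"
      by (rule balanced_adjoin_pair[OF G(1,3)]) simp
    moreover have "adjoin_pair G x x \<subseteq> K \<times> K"
    proof -
      have "Domain G \<subseteq> K" "Range G \<subseteq> K" using G(2) by auto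
      then have "Domain (adjoin_pair G x x) \<subseteq> K" "Range (adjoin_pair G x x) \<subseteq> K"
        using Domain_adjoin_pair_subset[OF K _ that] Range_adjoin_pair_subset[OF K _ that] by simp_all
      then show ?thesis by (auto simp: subset_iff)
    qed
    ultimately have "adjoin_pair G x x = G"
      by (intro max subset_adjoin_pair[OF G(1)])
    then show False using mem_adjoin_pair[OF G(1), of x x] x by blast
  qed
  then have "Domain G = K" using G(2) by blast
  then show ?thesis using that G DR by simp
qed

section \<open>The fixed field of the automorphism group\<close>

lemma partial_iso_Id_on_Rats: "partial_iso (Id_on \<rat>)"
  unfolding partial_iso_def by (auto simp: Id_on_iff)

lemma balanced_Id_on: "balanced (Id_on A)"
  by (auto simp: balanced_def)

lemma coeffs_rel_Id_on_iff: "coeffs_rel (Id_on A) p q \<longleftrightarrow> p = q \<and> (\<forall>i. coeff p i \<in> A)"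
  by (auto simp: coeffs_rel_def Id_on_iff poly_eq_iff)

text \<open>A minimal polynomial \<open>p\<close> over \<open>\<rat>\<close> is separable since its derivative has smaller degree,
  so it has a root different from \<open>z\<close> unless it is linear.\<close>

lemma exists_conjugate_algebraic:
  assumes z: "z \<notin> \<rat>" and p: "coeffs_rel (Id_on \<rat>) p p'" "p \<noteq> 0" "poly p z = 0"
  obtains z' q where "z' \<noteq> z" "partial_iso (adjoin_pair (Id_on \<rat>) z z')"
    "q \<noteq> 0" "\<And>i. coeff q i \<in> \<rat>" "poly q z = 0" "poly q z' = 0"
proof -
  from obtain_minimal_coeffs_rel[OF p] obtain q q' where q': "coeffs_rel (Id_on \<rat>) q q'"
    and q: "q \<noteq> 0" "poly q z = 0" and min':
    "\<And>f f'. coeffs_rel (Id_on \<rat>) f f' \<Longrightarrow> f \<noteq> 0 \<Longrightarrow> poly f z = 0 \<Longrightarrow> degree q \<le> degree f"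
    by metis
  have coeff_q: "coeff q i \<in> \<rat>" for i using q' unfolding coeffs_rel_Id_on_iff by blast
  have min: "degree q \<le> degree f" if "\<And>i. coeff f i \<in> \<rat>" "f \<noteq> 0" "poly f z = 0" for f
    using min'[of f f] that by (simp add: coeffs_rel_Id_on_iff)
  have deg: "degree q > 0" using q by (rule degree_pos_of_root)
  have "poly (pderiv q) z \<noteq> 0"
  proof
    assume "poly (pderiv q) z = 0"
    moreover have "pderiv q \<noteq> 0" using deg by (simp add: pderiv_eq_0_iff)
    moreover have "coeff (pderiv q) i \<in> \<rat>" for i
      using coeff_q by (simp add: coeff_pderiv)
    ultimately have "degree q \<le> degree (pderiv q)" by (intro min)
    then show False using deg by (simp add: degree_pderiv)
  qed
  obtain h where h: "q = [:- z, 1:] * h" using q(2) by (auto simp: poly_eq_0_iff_dvd)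
  \<comment> \<open>At \<open>z\<close> the derivative of \<open>q\<close> takes the same value as
    \<open>h\<close>, so no root of \<open>h\<close> can be \<open>z\<close>.\<close>
  have hz: "poly h z \<noteq> 0"
    using \<open>poly (pderiv q) z \<noteq> 0\<close> unfolding h pderiv_mult by (simp add: pderiv_pCons)
  have "h \<noteq> 0" using hz by auto
  have "degree q = Suc (degree h)"
    unfolding h using \<open>h \<noteq> 0\<close> by (subst degree_mult_eq) auto
  have "degree h > 0"
  proof (rule ccontr)
    assume "\<not> degree h > 0"
    then obtain c where c: "h = [:c:]" using degree_eq_zeroE by blast
    then have "c \<noteq> 0" using \<open>h \<noteq> 0\<close> by simp
    have "coeff q 0 = - z * c" "coeff q 1 = c" unfolding h c by simp_all
    then have "z = - (coeff q 0 / coeff q 1)" using \<open>c \<noteq> 0\<close> by simp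
    also have "\<dots> \<in> \<rat>" using coeff_q by (intro Rats_minus_iff[THEN iffD2] Rats_divide)
    finally show False using z by simp
  qed
  then obtain z' where "poly h z' = 0" using complex_poly_has_root by blast
  then have z': "z' \<noteq> z" "poly q z' = 0" using hz by (auto simp: h)
  have qq: "coeffs_rel (Id_on \<rat>) q q" using coeff_q by (simp add: coeffs_rel_Id_on_iff)
  have "partial_iso (adjoin_pair (Id_on \<rat>) z z')"
    using poly_zero_iff_minimal[OF partial_iso_Id_on_Rats qq q min' z'(2)]
    by (rule partial_iso_adjoin_pair[OF partial_iso_Id_on_Rats])
  then show ?thesis using that z' q coeff_q by blast
qed

text \<open>With \<open>z\<close> also \<open>- z\<close> is transcendental, because the
  substitution \<open>X \<mapsto> - X\<close> preserves rational coefficients. So only the zero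
  polynomial vanishes at either.\<close>

lemma partial_iso_adjoin_transcendental:
  assumes z: "\<And>p. (\<And>i. coeff p i \<in> \<rat>) \<Longrightarrow> poly p z = 0 \<Longrightarrow> p = 0"
  shows "partial_iso (adjoin_pair (Id_on \<rat>) z (- z))"
proof (rule partial_iso_adjoin_pair[OF partial_iso_Id_on_Rats])
  fix p q :: "complex poly" assume "coeffs_rel (Id_on \<rat>) p q"
  then have p: "q = p" "\<And>i. coeff p i \<in> \<rat>" by (auto simp: coeffs_rel_Id_on_iff)
  have "p = 0" if "poly p (- z) = 0"
  proof -
    have "pcompose p [:0, -1:] = 0"
    proof (rule z)
      show "coeff (pcompose p [:0, -1:]) i \<in> \<rat>" for i
        using p(2) by (simp add: coeff_pcompose_linear)
      show "poly (pcompose p [:0, -1:]) z = 0"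
        using that by (simp add: poly_pcompose)
    qed
    then have "(- 1) ^ i * coeff p i = 0" for i
      using coeff_pcompose_linear[of p "-1" i] by simp
    then show ?thesis by (simp add: poly_eq_iff)
  qed
  then show "poly p z = 0 \<longleftrightarrow> poly q (- z) = 0" using z[OF p(2)] p(1) by fastforce
qed

text \<open>The last conclusion supplies the balance of the adjoined pair. In the algebraic case
  both numbers are roots of one rational polynomial; otherwise \<open>z' = - z\<close>.\<close>

lemma exists_conjugate:
  assumes z: "z \<notin> \<rat>"
  obtains z' where "z' \<noteq> z" "partial_iso (adjoin_pair (Id_on \<rat>) z z')"
    "\<And>M. root_closed_ring M \<Longrightarrow> z \<in> M \<longleftrightarrow> z' \<in> M"
proof (cases "\<exists>p. (\<forall>i. coeff p i \<in> \<rat>) \<and> poly p z = 0 \<and> p \<noteq> 0")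
  case True
  then obtain p where p: "coeffs_rel (Id_on \<rat>) p p" "p \<noteq> 0" "poly p z = 0"
    by (auto simp: coeffs_rel_Id_on_iff)
  from exists_conjugate_algebraic[OF z p] obtain z' q where q: "z' \<noteq> z"
    "partial_iso (adjoin_pair (Id_on \<rat>) z z')" "q \<noteq> 0" "\<And>i. coeff q i \<in> \<rat>"
    "poly q z = 0" "poly q z' = 0" by metis
  moreover have "w \<in> M" if "root_closed_ring M" "poly q w = 0" for M w
    using root_closed_ringD[OF that(1) q(3) _ that(2)] q(4) Rats_subset_root_closed_ring[OF that(1)]
    by blast
  ultimately show ?thesis using that by blast
next
  case False
  then have "partial_iso (adjoin_pair (Id_on \<rat>) z (- z))"
    by (intro partial_iso_adjoin_transcendental) blast
  moreover have "z \<noteq> 0" using z by auto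
  then have "- z \<noteq> z" by simp
  moreover have "z \<in> M \<longleftrightarrow> - z \<in> M" if "root_closed_ring M" for M
    using root_closed_ring_uminus[OF that] by (metis minus_minus)
  ultimately show ?thesis using that by blast
qed

section \<open>Automorphisms from their graphs\<close>

lemma partial_iso_fixes_Rats:
  assumes G: "partial_iso G" and q: "q \<in> \<rat>" "(q, y) \<in> G"
  shows "y = q"
proof -
  have nat: "(of_nat n, of_nat n) \<in> G" for n
    by (induction n)
      (use partial_iso_zero[OF G] partial_iso_add[OF G partial_iso_one[OF G]] in auto)
  have int: "(of_int k, of_int k) \<in> G" for k
    using nat partial_iso_diff[OF G partial_iso_zero[OF G] nat]
    by (cases k rule: int_cases2) simp_all
  from q(1) obtain a b where "b > 0" and ab: "q = of_int a / of_int b"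
    by (elim Rats_cases')
  \<comment> \<open>Clearing the denominator reduces the claim to an integer, which is related to
    itself.\<close>
  then have "of_int b * q = of_int a" by simp
  then have "(of_int a, of_int b * y) \<in> G"
    using partial_iso_mult[OF G int[of b] q(2)] by simp
  from partial_iso_zero_iff[OF G partial_iso_diff[OF G this int[of a]]]
  have "of_int b * y = of_int b * q" using ab \<open>b > 0\<close> by simp
  then show ?thesis using \<open>b > 0\<close> by simp
qed

lemma rat_automorphisms_iff:
  "\<sigma> \<in> rat_automorphisms K \<longleftrightarrow> \<sigma> \<in> extensional K \<and> bij_betw \<sigma> K K \<and> \<sigma> 1 = 1 \<and>
     (\<forall>x\<in>K. \<forall>y\<in>K. \<sigma> (x + y) = \<sigma> x + \<sigma> y \<and> \<sigma> (x * y) = \<sigma> x * \<sigma> y) \<and> (\<forall>q\<in>\<rat>. \<sigma> q = q)"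
  unfolding rat_automorphisms_def ring_iso_def ring_hom_def ring_of_type_algebra_def
  by (auto simp: bij_betw_def)

text \<open>The condition at zero, applied to differences of pairs with a common entry, gives
  uniqueness of images and injectivity. Restriction to \<open>K\<close> makes the function
  extensional.\<close>

lemma rat_automorphism_of_partial_iso:
  assumes K: "root_closed_ring K" and G: "partial_iso G" "Domain G = K" "Range G = K"
  obtains \<sigma> where "\<sigma> \<in> rat_automorphisms K" "\<And>x y. (x, y) \<in> G \<Longrightarrow> \<sigma> x = y"
proof -
  define \<sigma> where "\<sigma> = (\<lambda>x\<in>K. THE y. (x, y) \<in> G)"
  have uniq: "b = d" if "(a, b) \<in> G" "(a, d) \<in> G" for a b d
    using partial_iso_zero_iff[OF G(1) partial_iso_diff[OF G(1) that]] by simp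
  have uniq': "a = c" if "(a, b) \<in> G" "(c, b) \<in> G" for a b c
    using partial_iso_zero_iff[OF G(1) partial_iso_diff[OF G(1) that]] by simp
  have eqI: "\<sigma> x = y" if "(x, y) \<in> G" for x y
  proof -
    have "x \<in> K" using that G(2) by blast
    moreover have "(THE y. (x, y) \<in> G) = y"
      using that uniq by blast
    ultimately show ?thesis by (simp add: \<sigma>_def)
  qed
  have mem: "(x, \<sigma> x) \<in> G" if "x \<in> K" for x
    using that G(2) eqI by blast
  have "bij_betw \<sigma> K K"
    unfolding bij_betw_def
  proof
    show "inj_on \<sigma> K" by (intro inj_onI uniq') (use mem in fastforce)+
    show "\<sigma> ` K = K"
    proof
      show "\<sigma> ` K \<subseteq> K" using mem G(3) by blast
      show "K \<subseteq> \<sigma> ` K" using eqI G(2,3) by blast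
    qed
  qed
  moreover have "\<sigma> q = q" if "q \<in> \<rat>" for q
    using that mem Rats_subset_root_closed_ring[OF K] partial_iso_fixes_Rats[OF G(1) that] by blast
  ultimately have "\<sigma> \<in> rat_automorphisms K"
    unfolding rat_automorphisms_iff
    using eqI mem partial_iso_one[OF G(1)] partial_iso_add[OF G(1)] partial_iso_mult[OF G(1)]
    by (auto simp: \<sigma>_def)
  then show ?thesis using that eqI by blast
qed

text \<open>For irrational \<open>z\<close>, the partial isomorphism sending \<open>z\<close> to a
  conjugate \<open>z' \<noteq> z\<close> extends to an automorphism of \<open>K\<close> that moves
  \<open>z\<close>.\<close>

theorem fixed_by_rat_automorphisms_imp_rational:
  assumes K: "root_closed_ring K" and z: "z \<in> K"
    and fixed: "\<And>\<sigma>. \<sigma> \<in> rat_automorphisms K \<Longrightarrow> \<sigma> z = z"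
  shows "z \<in> \<rat>"
proof (rule ccontr)
  assume "z \<notin> \<rat>"
  then obtain z' where z': "z' \<noteq> z" and iso: "partial_iso (adjoin_pair (Id_on \<rat>) z z')"
    and iff: "\<And>M. root_closed_ring M \<Longrightarrow> z \<in> M \<longleftrightarrow> z' \<in> M"
    using exists_conjugate by metis
  have "Domain (Id_on \<rat>) \<subseteq> K" "Range (Id_on \<rat>) \<subseteq> K"
    using Rats_subset_root_closed_ring[OF K] by auto
  moreover have "z' \<in> K" using iff[OF K] z by simp
  ultimately have "Domain (adjoin_pair (Id_on \<rat>) z z') \<subseteq> K" "Range (adjoin_pair (Id_on \<rat>) z z') \<subseteq> K"
    using Domain_adjoin_pair_subset[OF K _ z] Range_adjoin_pair_subset[OF K] by simp_all
  then have sub: "adjoin_pair (Id_on \<rat>) z z' \<subseteq> K \<times> K" by (auto simp: subset_iff)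
  have bal: "balanced (adjoin_pair (Id_on \<rat>) z z')"
    by (intro balanced_adjoin_pair partial_iso_Id_on_Rats balanced_Id_on iff)
  obtain G where G: "partial_iso G" "adjoin_pair (Id_on \<rat>) z z' \<subseteq> G" "Domain G = K" "Range G = K"
    using partial_iso_extends_to_automorphism[OF K iso sub bal] .
  obtain \<sigma> where "\<sigma> \<in> rat_automorphisms K" "\<And>x y. (x, y) \<in> G \<Longrightarrow> \<sigma> x = y"
    using rat_automorphism_of_partial_iso[OF K G(1,3,4)] by metis
  moreover have "(z, z') \<in> G"
    using mem_adjoin_pair[OF partial_iso_Id_on_Rats] G(2) by blast
  ultimately show False using fixed z' by blast
qed

section \<open>The algebraic closure of the coordinate field\<close>

lemma field_C_ring: "field C_ring"
  by (rule field_from_type_algebra)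

lemma C_ring_simps [simp]:
  "carrier C_ring = UNIV" "x \<otimes>\<^bsub>C_ring\<^esub> y = x * y" "x \<oplus>\<^bsub>C_ring\<^esub> y = x + y"
  "\<one>\<^bsub>C_ring\<^esub> = 1" "\<zero>\<^bsub>C_ring\<^esub> = 0"
  by (simp_all add: ring_of_type_algebra_def)

context
begin

interpretation C: field C_ring
  by (rule field_C_ring)

lemma C_ring_a_inv [simp]: "\<ominus>\<^bsub>C_ring\<^esub> x = - x"
  by (rule C.minus_equality) simp_all

text \<open>\<open>eval\<close> reads coefficient lists from the leading term down,
  \<open>Poly\<close> from the constant term up.\<close>

lemma C_ring_eval_rev: "C.eval (rev xs) x = poly (Poly xs) x"
proof (induction xs)
  case (Cons a xs)
  then show ?case
    using C.eval_append_aux[of "rev xs" a x] by (simp add: algebra_simps)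
qed simp

text \<open>Adjoining \<open>y\<close> to the extension by \<open>xs\<close> stays
  finite-dimensional over \<open>K\<close>, and elements of a finite-dimensional extension are
  algebraic.\<close>

lemma algebraic_over_finite_extension_imp_algebraic:
  assumes K: "subfield K C_ring" and xs: "\<And>x. x \<in> set xs \<Longrightarrow> (C.algebraic over K) x"
    and y: "(C.algebraic over (C.finite_extension K xs)) y"
  shows "(C.algebraic over K) y"
proof -
  let ?F = "C.finite_extension K xs"
  have F: "subfield ?F C_ring"
    by (rule C.finite_extension_is_subfield[OF K _ xs]) simp_all
  have fin: "C.finite_dimension K ?F"
    by (rule C.finite_extension_finite_dimension(1)[OF K _ xs]) simp_all
  have "C.finite_dimension ?F (C.simple_extension ?F y)"
    using C.finite_dimension_simple_extension[OF F, of y] y by simp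
  then have "C.finite_dimension K (C.simple_extension ?F y)"
    by (rule C.telescopic_base_dim(1)[OF K F fin])
  moreover have "subring (C.simple_extension ?F y) C_ring"
    by (rule C.simple_extension_is_subring) (use F in \<open>simp_all add: subfieldE(1)\<close>)
  moreover have "y \<in> C.simple_extension ?F y"
    by (rule C.simple_extension_mem) (use F in \<open>simp_all add: subfieldE(1)\<close>)
  ultimately show ?thesis
    using C.finite_dimension_imp_algebraic[OF K] by blast
qed

lemma subfield_coord_field: "subfield (coord_field \<gamma>) C_ring"
  unfolding coord_field_def by (rule C.generate_field_is_subfield) simp

lemma Omega_eq: "Omega \<gamma> = {z. (C.algebraic over (coord_field \<gamma>)) z}"
  by (simp add: Omega_def over_def)

lemma root_closed_ring_Omega: "root_closed_ring (Omega \<gamma>)"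
proof -
  let ?K = "coord_field \<gamma>"
  have "subfield (Omega \<gamma>) C_ring"
    using C.subfield_of_algebraics[OF subfield_coord_field[of \<gamma>]] by (simp add: Omega_eq)
  then have ring: "subring (Omega \<gamma>) C_ring" by (rule subfieldE)
  show ?thesis
    unfolding root_closed_ring_def
  proof (intro conjI ballI allI impI)
    show "1 \<in> Omega \<gamma>" using subringE(3)[OF ring] by simp
  next
    fix a b assume ab: "a \<in> Omega \<gamma>" "b \<in> Omega \<gamma>"
    then show "a - b \<in> Omega \<gamma>"
      using subringE(7)[OF ring ab(1) subringE(5)[OF ring ab(2)]] by simp
    show "a * b \<in> Omega \<gamma>" using subringE(6)[OF ring ab] by simp
  next
    fix p x assume p: "p \<noteq> 0" "\<forall>i. coeff p i \<in> Omega \<gamma>" "poly p x = 0"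
    have alg: "(C.algebraic over ?K) c" if "c \<in> set (coeffs p)" for c
      using that p(2) by (auto simp: coeffs_def Omega_eq split: if_splits)
    \<comment> \<open>\<open>x\<close> is algebraic over the finite extension generated by the
      coefficients of \<open>p\<close>, hence over the coordinate field.\<close>
    have "set (coeffs p) \<subseteq> C.finite_extension ?K (coeffs p)"
      by (rule C.finite_extension_mem) (simp_all add: subfieldE(1)[OF subfield_coord_field])
    moreover have "hd (rev (coeffs p)) \<noteq> 0"
      using p(1) by (simp add: hd_rev last_coeffs_eq_coeff_degree)
    ultimately have "rev (coeffs p) \<in> carrier ((C.finite_extension ?K (coeffs p))[X]\<^bsub>C_ring\<^esub>)"
      by (simp add: univ_poly_def polynomial_def)
    moreover have "C.eval (rev (coeffs p)) x = \<zero>\<^bsub>C_ring\<^esub>"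
      using p(3) by (simp add: C_ring_eval_rev)
    ultimately have "(C.algebraic over (C.finite_extension ?K (coeffs p))) x"
      using p(1) by (intro C.algebraicI[of "rev (coeffs p)"]) simp_all
    then show "x \<in> Omega \<gamma>"
      using algebraic_over_finite_extension_imp_algebraic[OF subfield_coord_field alg]
      by (simp add: Omega_eq)
  qed
qed

lemma coord_mem_Omega: "complex_of_real (\<gamma> $ i) \<in> Omega \<gamma>"
proof -
  have "of_real_vec \<gamma> $ i \<in> coord_field \<gamma>"
    unfolding coord_field_def by (rule generate_field.incl) blast
  then show ?thesis
    using C.algebraic_self[OF subfieldE(1)[OF subfield_coord_field]]
    by (simp add: Omega_eq of_real_vec_def)
qed

end

section \<open>Invariant linear relations\<close>

lemma rat_automorphism_bij: "\<sigma> \<in> rat_automorphisms K \<Longrightarrow> bij_betw \<sigma> K K"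
  and rat_automorphism_one: "\<sigma> \<in> rat_automorphisms K \<Longrightarrow> \<sigma> 1 = 1"
  and rat_automorphism_add:
    "\<sigma> \<in> rat_automorphisms K \<Longrightarrow> x \<in> K \<Longrightarrow> y \<in> K \<Longrightarrow> \<sigma> (x + y) = \<sigma> x + \<sigma> y"
  and rat_automorphism_mult:
    "\<sigma> \<in> rat_automorphisms K \<Longrightarrow> x \<in> K \<Longrightarrow> y \<in> K \<Longrightarrow> \<sigma> (x * y) = \<sigma> x * \<sigma> y"
  and rat_automorphism_Rats: "\<sigma> \<in> rat_automorphisms K \<Longrightarrow> q \<in> \<rat> \<Longrightarrow> \<sigma> q = q"
  by (auto simp: rat_automorphisms_iff)

lemma rat_automorphism_mem: "\<sigma> \<in> rat_automorphisms K \<Longrightarrow> x \<in> K \<Longrightarrow> \<sigma> x \<in> K"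
  using rat_automorphism_bij bij_betwE by blast

lemma rat_automorphism_sum:
  assumes K: "root_closed_ring K" and \<sigma>: "\<sigma> \<in> rat_automorphisms K" and f: "\<And>i. i \<in> I \<Longrightarrow> f i \<in> K"
  shows "\<sigma> (\<Sum>i\<in>I. f i) = (\<Sum>i\<in>I. \<sigma> (f i))"
  using f
proof (induction I rule: infinite_finite_induct)
  case (insert i I)
  then have "sum f I \<in> K" by (intro root_closed_ring_sum[OF K]) simp
  then show ?case using insert by (simp add: rat_automorphism_add[OF \<sigma>])
qed (simp_all add: rat_automorphism_Rats[OF \<sigma>])

lemma identity_rat_automorphism:
  assumes "root_closed_ring K"
  shows "(\<lambda>x\<in>K. x) \<in> rat_automorphisms K"
proof -
  have "bij_betw (\<lambda>x\<in>K. x) K K" by (auto simp: bij_betw_def inj_on_def image_iff)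
  then show ?thesis
    unfolding rat_automorphisms_iff
    using assms root_closed_ring_add root_closed_ring_mult root_closed_ring_one
      Rats_subset_root_closed_ring[OF assms]
    by (auto simp: subset_iff)
qed

text \<open>\<open>\<rho>\<close> is \<open>\<sigma>\<close> followed by the inverse of
  \<open>\<tau>\<close>. Applying \<open>\<tau>\<close> to a relation in values of
  \<open>\<rho>\<close> then yields one in values of \<open>\<sigma>\<close>.\<close>

lemma rat_automorphism_left_quotient:
  assumes K: "root_closed_ring K" and \<tau>: "\<tau> \<in> rat_automorphisms K" and \<sigma>: "\<sigma> \<in> rat_automorphisms K"
  obtains \<rho> where "\<rho> \<in> rat_automorphisms K" "\<And>x. x \<in> K \<Longrightarrow> \<tau> (\<rho> x) = \<sigma> x"
proof -
  define \<rho> where "\<rho> = restrict (inv_into K \<tau> \<circ> \<sigma>) K"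
  have bij: "bij_betw \<rho> K K"
    unfolding \<rho>_def bij_betw_restrict_eq
    using rat_automorphism_bij[OF \<sigma>] bij_betw_inv_into[OF rat_automorphism_bij[OF \<tau>]]
    by (rule bij_betw_trans)
  have \<tau>\<rho>: "\<tau> (\<rho> x) = \<sigma> x" if "x \<in> K" for x
    using bij_betw_inv_into_right[OF rat_automorphism_bij[OF \<tau>] rat_automorphism_mem[OF \<sigma> that]] that
    by (simp add: \<rho>_def)
  have mem: "\<rho> x \<in> K" if "x \<in> K" for x using bij that bij_betwE by blast
  have eqI: "\<rho> x = y" if "x \<in> K" "y \<in> K" "\<sigma> x = \<tau> y" for x y
    using \<tau>\<rho>[OF that(1)] that mem[OF that(1)] rat_automorphism_bij[OF \<tau>]
    by (auto simp: bij_betw_def inj_on_def)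
  have "\<rho> \<in> rat_automorphisms K"
    unfolding rat_automorphisms_iff
  proof (intro conjI ballI)
    show "\<rho> \<in> extensional K" by (simp add: \<rho>_def)
    have fixed: "\<rho> q = q" if "q \<in> \<rat>" for q
      using that Rats_subset_root_closed_ring[OF K] rat_automorphism_Rats[OF \<sigma>] rat_automorphism_Rats[OF \<tau>]
      by (intro eqI) auto
    show "\<rho> 1 = 1" by (rule fixed) simp
    fix q :: complex assume "q \<in> \<rat>" then show "\<rho> q = q" by (rule fixed)
  next
    fix x y assume xy: "x \<in> K" "y \<in> K"
    show "\<rho> (x + y) = \<rho> x + \<rho> y"
      using xy by (intro eqI)
        (simp_all add: root_closed_ring_add[OF K] mem \<tau>\<rho> rat_automorphism_add[OF \<sigma>] rat_automorphism_add[OF \<tau>])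
    show "\<rho> (x * y) = \<rho> x * \<rho> y"
      using xy by (intro eqI)
        (simp_all add: root_closed_ring_mult[OF K] mem \<tau>\<rho> rat_automorphism_mult[OF \<sigma>] rat_automorphism_mult[OF \<tau>])
  qed (rule bij)
  then show ?thesis using that \<tau>\<rho> by blast
qed

text \<open>Gaussian elimination: each step solves one equation for the unknown with index \<open>j\<close>.\<close>

lemma linear_system_descent:
  assumes K: "root_closed_ring K" and "finite I"
    and "\<And>a t. (a, t) \<in> E \<Longrightarrow> t \<in> K \<and> (\<forall>i\<in>I. a i \<in> K)"
    and "\<And>a t. (a, t) \<in> E \<Longrightarrow> (\<Sum>i\<in>I. v i * a i) = t"
  shows "\<exists>w. (\<forall>i\<in>I. w i \<in> K) \<and> (\<forall>a t. (a, t) \<in> E \<longrightarrow> (\<Sum>i\<in>I. w i * a i) = t)"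
  using assms(2-)
\<comment> \<open>The induction runs over the unknowns, since \<open>E\<close> may be
  infinite.\<close>
proof (induction I arbitrary: E rule: finite_induct)
  case empty
  then show ?case by auto
next
  case (insert j I)
  show ?case
  proof (cases "\<exists>a t. (a, t) \<in> E \<and> a j \<noteq> 0")
    case False
    then have zero: "a j = 0" if "(a, t) \<in> E" for a t using that by blast
    have "\<exists>w. (\<forall>i\<in>I. w i \<in> K) \<and> (\<forall>a t. (a, t) \<in> E \<longrightarrow> (\<Sum>i\<in>I. w i * a i) = t)"
    proof (rule insert.IH)
      fix a t assume *: "(a, t) \<in> E"
      show "t \<in> K \<and> (\<forall>i\<in>I. a i \<in> K)" using insert.prems(1)[OF *] by simp
      show "(\<Sum>i\<in>I. v i * a i) = t"
        using insert.prems(2)[OF *] insert.hyps zero[OF *] by simp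
    qed
    then obtain w where w: "\<And>i. i \<in> I \<Longrightarrow> w i \<in> K" "\<And>a t. (a, t) \<in> E \<Longrightarrow> (\<Sum>i\<in>I. w i * a i) = t"
      by blast
    have "(\<Sum>i\<in>insert j I. (w(j := 0)) i * a i) = t" if "(a, t) \<in> E" for a t
    proof -
      have "(\<Sum>i\<in>insert j I. (w(j := 0)) i * a i) = (\<Sum>i\<in>I. (w(j := 0)) i * a i)"
        using insert.hyps by simp
      also have "\<dots> = (\<Sum>i\<in>I. w i * a i)"
        using insert.hyps by (intro sum.cong) auto
      finally show ?thesis using w(2)[OF that] by simp
    qed
    then show ?thesis
      using w(1) root_closed_ring_zero[OF K] by (intro exI[of _ "w(j := 0)"]) auto
  next
    case True
    then obtain a0 t0 where a0: "(a0, t0) \<in> E" "a0 j \<noteq> 0" by blast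
    \<comment> \<open>The pivot equation \<open>(a0, t0)\<close> eliminates the unknown
      \<open>j\<close> from all equations.\<close>
    define E' where "E' = {(\<lambda>i. a i - a j / a0 j * a0 i, t - a j / a0 j * t0) |a t. (a, t) \<in> E}"
    have eq: "(\<Sum>i\<in>I. x i * (a i - c * a0 i)) = (\<Sum>i\<in>I. x i * a i) - c * (\<Sum>i\<in>I. x i * a0 i)"
      for x a and c :: complex
      by (simp add: sum_subtractf sum_distrib_left algebra_simps)
    have "\<exists>w. (\<forall>i\<in>I. w i \<in> K) \<and> (\<forall>a t. (a, t) \<in> E' \<longrightarrow> (\<Sum>i\<in>I. w i * a i) = t)"
    proof (rule insert.IH)
      fix a' t' assume "(a', t') \<in> E'"
      then obtain a t where a: "(a, t) \<in> E" "a' = (\<lambda>i. a i - a j / a0 j * a0 i)" "t' = t - a j / a0 j * t0"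
        unfolding E'_def by blast
      then show "t' \<in> K \<and> (\<forall>i\<in>I. a' i \<in> K)"
        using insert.prems(1)[OF a(1)] insert.prems(1)[OF a0(1)]
        by (auto intro!: root_closed_ring_diff[OF K] root_closed_ring_mult[OF K] root_closed_ring_divide[OF K])
      show "(\<Sum>i\<in>I. v i * a' i) = t'"
        unfolding a(2,3) eq
        using insert.prems(2)[OF a(1)] insert.prems(2)[OF a0(1)] insert.hyps a0(2)
        by (auto simp: field_simps)
    qed
    then obtain w where w: "\<And>i. i \<in> I \<Longrightarrow> w i \<in> K" "\<And>a t. (a, t) \<in> E' \<Longrightarrow> (\<Sum>i\<in>I. w i * a i) = t"
      by blast
    \<comment> \<open>Back substitution: the pivot equation forces this value on the unknown
      \<open>j\<close>.\<close>
    define c where "c = (t0 - (\<Sum>i\<in>I. w i * a0 i)) / a0 j"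
    have "c \<in> K"
      unfolding c_def using w(1) insert.prems(1)[OF a0(1)]
      by (intro root_closed_ring_divide[OF K] root_closed_ring_diff[OF K] root_closed_ring_sum[OF K]
          root_closed_ring_mult[OF K]) auto
    have "(\<Sum>i\<in>insert j I. (w(j := c)) i * a i) = t" if "(a, t) \<in> E" for a t
    proof -
      have "(\<Sum>i\<in>insert j I. (w(j := c)) i * a i) = c * a j + (\<Sum>i\<in>I. (w(j := c)) i * a i)"
        using insert.hyps by simp
      also have "(\<Sum>i\<in>I. (w(j := c)) i * a i) = (\<Sum>i\<in>I. w i * a i)"
        using insert.hyps by (intro sum.cong) auto
      also have "\<dots> = t - a j / a0 j * t0 + a j / a0 j * (\<Sum>i\<in>I. w i * a0 i)"
      proof -
        have "(\<lambda>i. a i - a j / a0 j * a0 i, t - a j / a0 j * t0) \<in> E'"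
          unfolding E'_def using that by blast
        from w(2)[OF this] show ?thesis unfolding eq by (simp add: algebra_simps)
      qed
      also have "c * a j + \<dots> = t" using a0(2) by (simp add: c_def field_simps)
      finally show ?thesis .
    qed
    then show ?thesis
      using w(1) \<open>c \<in> K\<close> by (intro exI[of _ "w(j := c)"]) auto
  qed
qed

text \<open>Artin's argument: normalise one coefficient of a solution over \<open>K\<close> to \<open>1\<close>; if some automorphism
  moves the solution, then the difference is a solution of smaller support.\<close>

lemma rational_relation_of_invariant_relation:
  assumes K: "root_closed_ring K" and "finite J" and "\<And>j. j \<in> J \<Longrightarrow> e j \<in> K"
    and "\<exists>j\<in>J. v j \<noteq> 0"
    and "\<And>\<sigma>. \<sigma> \<in> rat_automorphisms K \<Longrightarrow> (\<Sum>j\<in>J. v j * \<sigma> (e j)) = 0"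
  shows "\<exists>w. (\<forall>j\<in>J. w j \<in> \<rat>) \<and> (\<exists>j\<in>J. w j \<noteq> 0) \<and> (\<Sum>j\<in>J. w j * e j) = 0"
  using assms(2-)
proof (induction J arbitrary: v rule: finite_psubset_induct)
  case (psubset J)
  from psubset.prems(2) obtain k where k: "k \<in> J" "v k \<noteq> 0" by blast
  \<comment> \<open>With the unknown at \<open>k\<close> set to \<open>1\<close>, the relations
    become inhomogeneous equations with coefficients in \<open>K\<close>, solved over the complex
    numbers by \<open>v j / v k\<close>.\<close>
  define E where "E = {(\<lambda>j. \<sigma> (e j), - \<sigma> (e k)) |\<sigma>. \<sigma> \<in> rat_automorphisms K}"
  have "\<exists>w. (\<forall>i\<in>J - {k}. w i \<in> K) \<and> (\<forall>a t. (a, t) \<in> E \<longrightarrow> (\<Sum>i\<in>J - {k}. w i * a i) = t)"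
  proof (rule linear_system_descent[OF K, where v = "\<lambda>j. v j / v k"])
    fix a t assume "(a, t) \<in> E"
    then obtain \<sigma> where \<sigma>: "\<sigma> \<in> rat_automorphisms K" "a = (\<lambda>j. \<sigma> (e j))" "t = - \<sigma> (e k)"
      unfolding E_def by blast
    then show "t \<in> K \<and> (\<forall>i\<in>J - {k}. a i \<in> K)"
      using psubset.prems(1) k(1) rat_automorphism_mem[OF \<sigma>(1)] root_closed_ring_uminus[OF K] by blast
    have "v k * \<sigma> (e k) + (\<Sum>j\<in>J - {k}. v j * \<sigma> (e j)) = 0"
      using psubset.prems(3)[OF \<sigma>(1)] k(1) psubset.hyps by (simp add: sum.remove)
    then have "(\<Sum>j\<in>J - {k}. v j * \<sigma> (e j)) / v k = - \<sigma> (e k)"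
      using k(2) by (simp add: field_simps add_eq_0_iff)
    then show "(\<Sum>i\<in>J - {k}. v i / v k * a i) = t"
      unfolding \<sigma>(2,3) by (simp add: sum_divide_distrib)
  qed (use psubset.hyps in simp)
  then obtain w where w: "\<And>i. i \<in> J - {k} \<Longrightarrow> w i \<in> K"
    and w_E: "\<And>a t. (a, t) \<in> E \<Longrightarrow> (\<Sum>i\<in>J - {k}. w i * a i) = t"
    by blast
  define W where "W = w(k := 1)"
  have W: "W j \<in> K" if "j \<in> J" for j
    using w that root_closed_ring_one[OF K] by (auto simp: W_def)
  have sumW: "(\<Sum>j\<in>J. W j * \<sigma> (e j)) = 0" if "\<sigma> \<in> rat_automorphisms K" for \<sigma>
  proof -
    have "(\<lambda>j. \<sigma> (e j), - \<sigma> (e k)) \<in> E" unfolding E_def using that by blast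
    from w_E[OF this] have "(\<Sum>i\<in>J - {k}. w i * \<sigma> (e i)) = - \<sigma> (e k)" .
    moreover have "(\<Sum>i\<in>J - {k}. W i * \<sigma> (e i)) = (\<Sum>i\<in>J - {k}. w i * \<sigma> (e i))"
      by (intro sum.cong) (auto simp: W_def)
    ultimately show ?thesis
      using k(1) psubset.hyps by (simp add: sum.remove[of J k] W_def)
  qed
  show ?case
  proof (cases "\<forall>\<sigma>\<in>rat_automorphisms K. \<forall>j\<in>J. \<sigma> (W j) = W j")
    case True
    then have "W j \<in> \<rat>" if "j \<in> J" for j
      using that by (intro fixed_by_rat_automorphisms_imp_rational[OF K W]) auto
    moreover have "W k \<noteq> 0" by (simp add: W_def)
    \<comment> \<open>The identity automorphism yields the relation for \<open>e\<close>
      itself.\<close>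
    moreover have "(\<Sum>j\<in>J. W j * e j) = 0"
      using sumW[OF identity_rat_automorphism[OF K]] psubset.prems(1) by (simp cong: sum.cong)
    ultimately show ?thesis using k(1) by blast
  next
    case False
    then obtain \<tau> j0 where \<tau>: "\<tau> \<in> rat_automorphisms K" and j0: "j0 \<in> J" "\<tau> (W j0) \<noteq> W j0" by blast
    define u where "u j = \<tau> (W j) - W j" for j
    have uk: "u k = 0" using rat_automorphism_one[OF \<tau>] by (simp add: u_def W_def)
    have sum_u: "(\<Sum>j\<in>J. u j * \<sigma> (e j)) = 0" if \<sigma>: "\<sigma> \<in> rat_automorphisms K" for \<sigma>
    proof -
      obtain \<rho> where \<rho>: "\<rho> \<in> rat_automorphisms K" "\<And>x. x \<in> K \<Longrightarrow> \<tau> (\<rho> x) = \<sigma> x"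
        using rat_automorphism_left_quotient[OF K \<tau> \<sigma>] by metis
      have mem: "\<rho> (e j) \<in> K" if "j \<in> J" for j
        using rat_automorphism_mem[OF \<rho>(1)] psubset.prems(1) that by blast
      \<comment> \<open>Applying \<open>\<tau>\<close> to the relation for \<open>\<rho>\<close>
        shows that the moved coefficients \<open>\<tau> (W j)\<close> satisfy the relation for
        \<open>\<sigma>\<close>.\<close>
      have "(\<Sum>j\<in>J. \<tau> (W j) * \<sigma> (e j)) = (\<Sum>j\<in>J. \<tau> (W j * \<rho> (e j)))"
        using W mem \<rho>(2) psubset.prems(1) by (intro sum.cong) (simp_all add: rat_automorphism_mult[OF \<tau>])
      also have "\<dots> = \<tau> (\<Sum>j\<in>J. W j * \<rho> (e j))"
        using W mem by (intro rat_automorphism_sum[OF K \<tau>, symmetric] root_closed_ring_mult[OF K])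
      also have "\<dots> = 0" using sumW[OF \<rho>(1)] rat_automorphism_Rats[OF \<tau>, of 0] by simp
      finally show ?thesis
        using sumW[OF \<sigma>] by (simp add: u_def left_diff_distrib sum_subtractf)
    qed
    have sub: "J - {k} \<subset> J" using k(1) by blast
    have "\<exists>w. (\<forall>j\<in>J - {k}. w j \<in> \<rat>) \<and> (\<exists>j\<in>J - {k}. w j \<noteq> 0) \<and> (\<Sum>j\<in>J - {k}. w j * e j) = 0"
    proof (rule psubset.IH[OF sub])
      show "e j \<in> K" if "j \<in> J - {k}" for j using psubset.prems(1) that by blast
      have "u j0 \<noteq> 0" using j0 by (simp add: u_def)
      then show "\<exists>j\<in>J - {k}. u j \<noteq> 0" using uk j0(1) by (intro bexI[of _ j0]) auto
      show "(\<Sum>j\<in>J - {k}. u j * \<sigma> (e j)) = 0" if "\<sigma> \<in> rat_automorphisms K" for \<sigma>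
        using sum_u[OF that] k(1) psubset.hyps uk by (simp add: sum.remove[of J k])
    qed
    then obtain w' where w': "\<forall>j\<in>J - {k}. w' j \<in> \<rat>" "\<exists>j\<in>J - {k}. w' j \<noteq> 0"
      "(\<Sum>j\<in>J - {k}. w' j * e j) = 0" by blast
    define w'' where "w'' = w'(k := 0)"
    have "(\<Sum>j\<in>J - {k}. w'' j * e j) = 0"
      using w'(3) by (subst sum.cong[of _ "J - {k}" _ "\<lambda>j. w' j * e j"]) (auto simp: w''_def)
    then have "(\<Sum>j\<in>J. w'' j * e j) = 0"
      using k(1) psubset.hyps by (simp add: sum.remove[of J k] w''_def)
    moreover have "\<forall>j\<in>J. w'' j \<in> \<rat>" "\<exists>j\<in>J. w'' j \<noteq> 0"
      using w'(1,2) by (auto simp: w''_def)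
    ultimately show ?thesis by blast
  qed
qed

section \<open>Density of rational points\<close>

text \<open>For \<open>\<delta> = \<gamma> - b\<close>, the rational directions in which the line
  through \<open>b\<close> has a rational second intersection with the sphere; together with
  \<open>0\<close> they form a vector space over the rationals.\<close>

definition rational_value_vectors :: "real ^ 'n \<Rightarrow> (real ^ 'n) set" where
  "rational_value_vectors \<delta> = {w. (\<forall>i. w $ i \<in> \<rat>) \<and> \<delta> \<bullet> w \<in> \<rat>}"

lemma complex_Rats_eq_of_real_Re:
  assumes "z \<in> \<rat>" shows "z = complex_of_real (Re z)" "Re z \<in> \<rat>"
proof -
  from assms obtain a b where "z = of_int a / of_int b" by (elim Rats_cases')
  then have "z = complex_of_real (of_int a / of_int b)" by simp
  then show "z = complex_of_real (Re z)" by simp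
  with assms show "Re z \<in> \<rat>" by (metis Rats_complex_of_real_iff)
qed

text \<open>Applied to the relation \<open>\<Sum>\<^sub>i u\<^sub>i \<delta>\<^sub>i - c = 0\<close>, Artin's lemma yields a rational
  vector in the support of \<open>u\<close>, a multiple of which can be split off to shrink that support.\<close>

lemma invariant_value_imp_span:
  fixes \<delta> u :: "real ^ 'n" and c :: real
  assumes K: "root_closed_ring K" and \<delta>: "\<And>i. complex_of_real (\<delta> $ i) \<in> K"
    and "\<And>\<sigma>. \<sigma> \<in> rat_automorphisms K \<Longrightarrow>
      (\<Sum>i\<in>UNIV. complex_of_real (u $ i) * \<sigma> (complex_of_real (\<delta> $ i))) = complex_of_real c"
  shows "u \<in> span (rational_value_vectors \<delta>)"
  using assms(3)
proof (induction "card {i. u $ i \<noteq> 0}" arbitrary: u c rule: less_induct)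
  case less
  show ?case
  proof (cases "u = 0")
    case True
    then show ?thesis by (simp add: span_zero)
  next
    case False
    define S where "S = {i. u $ i \<noteq> 0}"
    \<comment> \<open>The index \<open>None\<close> carries the constant: there \<open>e\<close> is
      \<open>1\<close> and \<open>v\<close> is \<open>- c\<close>, so the hypothesis becomes a
      homogeneous relation.\<close>
    define J where "J = insert None (Some ` S)"
    define e where "e j = (case j of None \<Rightarrow> 1 | Some i \<Rightarrow> complex_of_real (\<delta> $ i))" for j
    define v where "v j = (case j of None \<Rightarrow> - complex_of_real c | Some i \<Rightarrow> complex_of_real (u $ i))" for j
    have sumJ: "(\<Sum>j\<in>J. f j) = f None + (\<Sum>i\<in>S. f (Some i))" for f :: "'n option \<Rightarrow> complex"
      by (simp add: J_def sum.reindex)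
    have sumS: "(\<Sum>i\<in>S. complex_of_real (x $ i) * g i) = (\<Sum>i\<in>UNIV. complex_of_real (x $ i) * g i)"
      if "\<And>i. i \<notin> S \<Longrightarrow> x $ i = 0" for x :: "real ^ 'n" and g
      using that by (intro sum.mono_neutral_left) auto
    have "\<exists>w. (\<forall>j\<in>J. w j \<in> \<rat>) \<and> (\<exists>j\<in>J. w j \<noteq> 0) \<and> (\<Sum>j\<in>J. w j * e j) = 0"
    proof (rule rational_relation_of_invariant_relation[OF K])
      show "finite J" by (simp add: J_def)
      show "e j \<in> K" for j
        using \<delta> root_closed_ring_one[OF K] by (simp add: e_def split: option.splits)
      from False obtain i where "u $ i \<noteq> 0" by (auto simp: vec_eq_iff)
      then show "\<exists>j\<in>J. v j \<noteq> 0"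
        by (intro bexI[of _ "Some i"]) (auto simp: v_def J_def S_def)
      fix \<sigma> assume \<sigma>: "\<sigma> \<in> rat_automorphisms K"
      show "(\<Sum>j\<in>J. v j * \<sigma> (e j)) = 0"
        using less.prems[OF \<sigma>] rat_automorphism_one[OF \<sigma>]
          sumS[of u "\<lambda>i. \<sigma> (complex_of_real (\<delta> $ i))"]
        by (simp add: sumJ v_def e_def S_def)
    qed
    then obtain q where q: "\<And>j. j \<in> J \<Longrightarrow> q j \<in> \<rat>" "\<exists>j\<in>J. q j \<noteq> 0" "(\<Sum>j\<in>J. q j * e j) = 0" by blast
    define w :: "real ^ 'n" where "w = (\<chi> i. if i \<in> S then Re (q (Some i)) else 0)"
    have wS: "complex_of_real (w $ i) = q (Some i)" "w $ i \<in> \<rat>" if "i \<in> S" for i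
      using complex_Rats_eq_of_real_Re[of "q (Some i)"] q(1)[of "Some i"] that
      by (simp_all add: w_def J_def)
    have w0: "w $ i = 0" if "i \<notin> S" for i using that by (simp add: w_def)
    have q0: "q None \<in> \<rat>" using q(1) by (simp add: J_def)
    have w_value: "(\<Sum>i\<in>UNIV. complex_of_real (w $ i) * complex_of_real (\<delta> $ i)) = - q None"
    proof -
      have "(\<Sum>i\<in>S. complex_of_real (w $ i) * complex_of_real (\<delta> $ i)) = (\<Sum>i\<in>S. q (Some i) * e (Some i))"
        by (intro sum.cong) (simp_all add: wS e_def)
      also have "\<dots> = - q None" using q(3) by (simp add: sumJ e_def add_eq_0_iff)
      finally show ?thesis using sumS[OF w0] by simp
    qed
    have "complex_of_real (\<delta> \<bullet> w) = - q None"
      using w_value by (simp add: inner_vec_def mult.commute)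
    moreover have "- q None \<in> \<rat>" using q0 by simp
    ultimately have \<delta>w: "\<delta> \<bullet> w \<in> \<rat>" by (metis Rats_complex_of_real_iff)
    have "w $ i \<in> \<rat>" for i using wS(2) w0 by (cases "i \<in> S") auto
    then have w_mem: "w \<in> rational_value_vectors \<delta>"
      using \<delta>w by (simp add: rational_value_vectors_def)
    have "\<exists>i\<in>S. w $ i \<noteq> 0"
    proof (rule ccontr)
      \<comment> \<open>If all these coordinates were zero, \<open>q None\<close> would vanish as
        well, and \<open>q\<close> would be trivial.\<close>
      assume "\<not> (\<exists>i\<in>S. w $ i \<noteq> 0)"
      then have "w $ i = 0" for i using w0 by blast
      then have "q None = 0" using w_value by simp
      moreover have "q (Some i) = 0" if "i \<in> S" for i
        using wS(1)[OF that] \<open>\<And>i. w $ i = 0\<close> by simp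
      ultimately show False using q(2) by (auto simp: J_def)
    qed
    then obtain k where k: "k \<in> S" "w $ k \<noteq> 0" by blast
    \<comment> \<open>\<open>t\<close> makes coordinate \<open>k\<close> of \<open>u'\<close> zero;
      no coordinate outside the support of \<open>u\<close> is added.\<close>
    define t where "t = u $ k / w $ k"
    define u' where "u' = u - t *\<^sub>R w"
    have "{i. u' $ i \<noteq> 0} \<subseteq> S - {k}"
      using w0 k by (auto simp: u'_def t_def S_def)
    then have "{i. u' $ i \<noteq> 0} \<subset> {i. u $ i \<noteq> 0}" using k(1) by (auto simp: S_def)
    then have "card {i. u' $ i \<noteq> 0} < card {i. u $ i \<noteq> 0}" by (intro psubset_card_mono) auto
    then have "u' \<in> span (rational_value_vectors \<delta>)"
    proof (rule less.hyps)
      fix \<sigma> assume \<sigma>: "\<sigma> \<in> rat_automorphisms K"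
      \<comment> \<open>\<open>w\<close> and \<open>\<delta> \<bullet> w\<close> are rational, so
        \<open>w\<close> contributes the same value for every automorphism, and the hypothesis holds
        again for \<open>u'\<close> with an adjusted constant.\<close>
      have w_K: "complex_of_real (w $ i) \<in> K" and w_fix: "\<sigma> (complex_of_real (w $ i)) = complex_of_real (w $ i)"
        for i
        using \<open>\<And>i. w $ i \<in> \<rat>\<close> Rats_subset_root_closed_ring[OF K] rat_automorphism_Rats[OF \<sigma>]
        by auto
      have "(\<Sum>i\<in>UNIV. complex_of_real (w $ i) * \<sigma> (complex_of_real (\<delta> $ i)))
          = (\<Sum>i\<in>UNIV. \<sigma> (complex_of_real (w $ i) * complex_of_real (\<delta> $ i)))"
        by (simp add: rat_automorphism_mult[OF \<sigma> w_K \<delta>] w_fix)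
      also have "\<dots> = \<sigma> (\<Sum>i\<in>UNIV. complex_of_real (w $ i) * complex_of_real (\<delta> $ i))"
        by (intro rat_automorphism_sum[OF K \<sigma>, symmetric] root_closed_ring_mult[OF K] w_K \<delta>)
      also have "\<dots> = \<sigma> (complex_of_real (\<delta> \<bullet> w))"
        by (simp add: inner_vec_def mult.commute)
      also have "\<dots> = complex_of_real (\<delta> \<bullet> w)"
        using \<delta>w by (intro rat_automorphism_Rats[OF \<sigma>]) simp
      finally show "(\<Sum>i\<in>UNIV. complex_of_real (u' $ i) * \<sigma> (complex_of_real (\<delta> $ i)))
          = complex_of_real (c - t * (\<delta> \<bullet> w))"
        using less.prems[OF \<sigma>]
        by (simp add: u'_def left_diff_distrib sum_subtractf mult.assoc flip: sum_distrib_left)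
    qed
    then have "u' + t *\<^sub>R w \<in> span (rational_value_vectors \<delta>)"
      by (rule span_add[OF _ span_scale[OF span_base[OF w_mem]]])
    then show ?thesis by (simp add: u'_def)
  qed
qed

text \<open>Real multiples are limits of rational multiples, so the closure of \<open>L\<close> is a
  real subspace.\<close>

lemma span_subset_closure_rational_subspace:
  fixes L :: "'a::real_normed_vector set"
  assumes zero: "0 \<in> L" and add: "\<And>x y. x \<in> L \<Longrightarrow> y \<in> L \<Longrightarrow> x + y \<in> L"
    and scale: "\<And>q x. q \<in> \<rat> \<Longrightarrow> x \<in> L \<Longrightarrow> q *\<^sub>R x \<in> L"
  shows "span L \<subseteq> closure L"
proof (rule span_minimal[OF closure_subset])
  show "subspace (closure L)"
    unfolding subspace_def
  proof (intro conjI ballI allI)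
    show "0 \<in> closure L" using zero closure_subset by blast
  next
    fix x y assume "x \<in> closure L" "y \<in> closure L"
    then obtain f g where "\<And>n. f n \<in> L" "f \<longlonglongrightarrow> x" "\<And>n. g n \<in> L" "g \<longlonglongrightarrow> y"
      unfolding closure_sequential by blast
    then show "x + y \<in> closure L"
      unfolding closure_sequential using add
      by (intro exI[of _ "\<lambda>n. f n + g n"]) (auto intro: tendsto_add)
  next
    fix c :: real and x assume "x \<in> closure L"
    then obtain f where f: "\<And>n. f n \<in> L" "f \<longlonglongrightarrow> x"
      unfolding closure_sequential by blast
    have "c \<in> closure \<rat>" by (simp add: Rats_closure_real)
    then obtain q where q: "\<And>n. q n \<in> \<rat>" "q \<longlonglongrightarrow> c"
      unfolding closure_sequential by blast
    show "c *\<^sub>R x \<in> closure L"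
      unfolding closure_sequential using f q scale
      by (intro exI[of _ "\<lambda>n. q n *\<^sub>R f n"]) (auto intro: tendsto_scaleR)
  qed
qed

lemma span_rational_value_vectors_subset:
  "span (rational_value_vectors \<delta>) \<subseteq> closure (rational_value_vectors \<delta>)"
  by (rule span_subset_closure_rational_subspace)
    (auto simp: rational_value_vectors_def inner_add_right)

section \<open>Equations for spheres and hyperplanes\<close>

lemma mem_sphere_iff_inner:
  fixes a b x :: "'a::real_inner"
  shows "norm (x - a) = norm (b - a) \<longleftrightarrow> (x - b) \<bullet> (a - b) = (norm (x - b))\<^sup>2 / 2"
proof -
  have "norm (x - a) = norm (b - a) \<longleftrightarrow> (x - a) \<bullet> (x - a) = (b - a) \<bullet> (b - a)"
    by (simp add: norm_eq_sqrt_inner)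
  \<comment> \<open>With \<open>x - a = (x - b) - (a - b)\<close>, the squared norm of
    \<open>a - b\<close> cancels.\<close>
  also have "\<dots> \<longleftrightarrow> (x - b) \<bullet> (a - b) = (norm (x - b))\<^sup>2 / 2"
    by (auto simp: power2_norm_eq_inner inner_diff_left inner_diff_right inner_commute algebra_simps)
  finally show ?thesis .
qed

text \<open>The real part of the complex equation is the sphere condition, the imaginary part that
  of the hyperplane.\<close>

lemma mem_sphere_hyperplane_iff:
  fixes b x :: "real ^ 'n" and z :: "complex ^ 'n"
  shows "x \<in> sphere_through b (Re_vec z) \<inter> hyperplane_through b (Im_vec z) \<longleftrightarrow>
    (\<Sum>i\<in>UNIV. complex_of_real ((x - b) $ i) * (z $ i - complex_of_real (b $ i)))
      = complex_of_real ((norm (x - b))\<^sup>2 / 2)"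
  unfolding sphere_through_def hyperplane_through_def mem_sphere_iff_inner complex_eq_iff
  by (simp add: Re_vec_def Im_vec_def inner_vec_def mult.commute)

text \<open>The second intersection of the sphere with the line through \<open>b\<close> in direction \<open>l\<close>.\<close>

lemma second_intersection_mem:
  fixes \<gamma> b l :: "real ^ 'n"
  assumes "b \<in> rational_points" "l \<in> rational_value_vectors (\<gamma> - b)"
  shows "b + (2 * ((\<gamma> - b) \<bullet> l) / (l \<bullet> l)) *\<^sub>R l \<in> sphere \<gamma> (norm (b - \<gamma>)) \<inter> rational_points"
proof
  define s where "s = 2 * ((\<gamma> - b) \<bullet> l) / (l \<bullet> l)"
  have l: "l $ i \<in> \<rat>" for i using assms(2) by (simp add: rational_value_vectors_def)
  have "(\<gamma> - b) \<bullet> l \<in> \<rat>" using assms(2) by (simp add: rational_value_vectors_def)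
  moreover have "l \<bullet> l \<in> \<rat>"
    unfolding inner_vec_def using l by (intro Rats_sum) auto
  ultimately have "s \<in> \<rat>" by (simp add: s_def)
  then show "b + s *\<^sub>R l \<in> rational_points"
    using l assms(1) by (simp add: rational_points_def)
  have "s *\<^sub>R l \<bullet> (\<gamma> - b) = (norm (s *\<^sub>R l))\<^sup>2 / 2"
  proof -
    \<comment> \<open>For \<open>l = 0\<close> both sides are \<open>0\<close>.\<close>
    have "s * (l \<bullet> l) = 2 * ((\<gamma> - b) \<bullet> l)" by (simp add: s_def)
    then have "s * (s * (l \<bullet> l)) = s * (2 * ((\<gamma> - b) \<bullet> l))" by simp
    then show ?thesis unfolding power2_norm_eq_inner by (auto simp: inner_commute mult.commute)
  qed
  then have "norm (b + s *\<^sub>R l - \<gamma>) = norm (b - \<gamma>)"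
    unfolding mem_sphere_iff_inner by simp
  then show "b + s *\<^sub>R l \<in> sphere \<gamma> (norm (b - \<gamma>))"
    by (simp add: dist_norm norm_minus_commute)
qed

text \<open>Approximating a nonzero \<open>u\<close> by vectors with rational values gives rational
  points of the sphere, since the second intersection varies continuously with a nonzero direction.
  For \<open>u = 0\<close> the point is \<open>b\<close>.\<close>

lemma closure_rational_points_sphere:
  fixes \<gamma> b u :: "real ^ 'n"
  assumes b: "b \<in> rational_points" and u: "u \<in> span (rational_value_vectors (\<gamma> - b))"
    and sphere: "u \<bullet> (\<gamma> - b) = (norm u)\<^sup>2 / 2"
  shows "b + u \<in> closure (sphere \<gamma> (norm (b - \<gamma>)) \<inter> rational_points)"
proof (cases "u = 0")
  case True
  then show ?thesis
    using b closure_subset by (force simp: dist_norm norm_minus_commute)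
next
  case False
  have "u \<in> closure (rational_value_vectors (\<gamma> - b))"
    using u span_rational_value_vectors_subset by blast
  then obtain l where l: "\<And>n. l n \<in> rational_value_vectors (\<gamma> - b)" "l \<longlonglongrightarrow> u"
    unfolding closure_sequential by blast
  have "(\<lambda>n. b + (2 * ((\<gamma> - b) \<bullet> l n) / (l n \<bullet> l n)) *\<^sub>R l n)
      \<longlonglongrightarrow> b + (2 * ((\<gamma> - b) \<bullet> u) / (u \<bullet> u)) *\<^sub>R u"
    using False by (intro tendsto_intros l(2)) simp
  \<comment> \<open>By the sphere equation the second intersection in direction \<open>u\<close> is
    \<open>b + u\<close>.\<close>
  moreover have "2 * ((\<gamma> - b) \<bullet> u) / (u \<bullet> u) = 1"
    using sphere False by (simp add: power2_norm_eq_inner inner_commute)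
  ultimately show ?thesis
    unfolding closure_sequential using second_intersection_mem[OF b l(1)]
    by (intro exI[of _ "\<lambda>n. b + (2 * ((\<gamma> - b) \<bullet> l n) / (l n \<bullet> l n)) *\<^sub>R l n"]) auto
qed

theorem theorem1p3:
  fixes \<gamma> b :: "real ^ 'n" and r :: real
  assumes "b \<in> sphere \<gamma> r \<inter> rational_points"
  shows "closure (sphere \<gamma> r \<inter> rational_points) =
    (\<Inter>\<sigma>\<in>rat_automorphisms (Omega \<gamma>).
       sphere_through b (Re_vec (apply_coords \<sigma> (of_real_vec \<gamma>))) \<inter>
       hyperplane_through b (Im_vec (apply_coords \<sigma> (of_real_vec \<gamma>))))"
proof -
  define \<delta> where "\<delta> = \<gamma> - b"
  let ?K = "Omega \<gamma>"
  let ?T = "\<lambda>\<sigma>. sphere_through b (Re_vec (apply_coords \<sigma> (of_real_vec \<gamma>))) \<inter>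
       hyperplane_through b (Im_vec (apply_coords \<sigma> (of_real_vec \<gamma>)))"
  note K = root_closed_ring_Omega[of \<gamma>]
  have b: "b \<in> rational_points" and r: "r = norm (b - \<gamma>)"
    using assms by (auto simp: dist_norm norm_minus_commute)
  have rat_K: "complex_of_real q \<in> ?K" if "q \<in> \<rat>" for q
    using Rats_subset_root_closed_ring[OF K] that by auto
  have bK: "complex_of_real (b $ i) \<in> ?K" for i
    using b by (intro rat_K) (simp add: rational_points_def)
  have \<delta>K: "complex_of_real (\<delta> $ i) \<in> ?K" for i
    using root_closed_ring_diff[OF K coord_mem_Omega bK] by (simp add: \<delta>_def)
  have mem_iff: "x \<in> ?T \<sigma> \<longleftrightarrow>
      (\<Sum>i\<in>UNIV. complex_of_real ((x - b) $ i) * \<sigma> (complex_of_real (\<delta> $ i)))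
        = complex_of_real ((norm (x - b))\<^sup>2 / 2)"
    if \<sigma>: "\<sigma> \<in> rat_automorphisms ?K" for \<sigma> x
  proof -
    \<comment> \<open>The coordinates of \<open>b\<close> are rational, so \<open>\<sigma>\<close>
      commutes with the shift from \<open>\<gamma>\<close> to \<open>\<delta>\<close>.\<close>
    have "\<sigma> (complex_of_real (\<delta> $ i)) = \<sigma> (complex_of_real (\<gamma> $ i)) - complex_of_real (b $ i)" for i
    proof -
      have "\<sigma> (complex_of_real (\<gamma> $ i)) = \<sigma> (complex_of_real (\<delta> $ i) + complex_of_real (b $ i))"
        by (simp add: \<delta>_def)
      also have "\<dots> = \<sigma> (complex_of_real (\<delta> $ i)) + \<sigma> (complex_of_real (b $ i))"
        by (rule rat_automorphism_add[OF \<sigma> \<delta>K bK])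
      also have "\<sigma> (complex_of_real (b $ i)) = complex_of_real (b $ i)"
        using b by (intro rat_automorphism_Rats[OF \<sigma>]) (simp add: rational_points_def)
      finally show ?thesis by simp
    qed
    then show ?thesis
      by (subst mem_sphere_hyperplane_iff) (simp add: apply_coords_def of_real_vec_def)
  qed
  show ?thesis
  proof
    show "closure (sphere \<gamma> r \<inter> rational_points) \<subseteq> (\<Inter>\<sigma>\<in>rat_automorphisms ?K. ?T \<sigma>)"
    proof (rule closure_minimal)
      have "closed (?T \<sigma>)" for \<sigma>
        unfolding sphere_through_def hyperplane_through_def
        by (intro closed_Int closed_Collect_eq continuous_intros)
      then show "closed (\<Inter>\<sigma>\<in>rat_automorphisms ?K. ?T \<sigma>)" by blast
      show "sphere \<gamma> r \<inter> rational_points \<subseteq> (\<Inter>\<sigma>\<in>rat_automorphisms ?K. ?T \<sigma>)"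
      proof (intro subsetI INT_I)
        fix x \<sigma> assume x: "x \<in> sphere \<gamma> r \<inter> rational_points" and \<sigma>: "\<sigma> \<in> rat_automorphisms ?K"
        define u where "u = x - b"
        have u: "u $ i \<in> \<rat>" for i using x b by (simp add: u_def rational_points_def)
        have "norm (x - \<gamma>) = norm (b - \<gamma>)"
          using x r by (simp add: dist_norm norm_minus_commute)
        then have u\<delta>: "u \<bullet> \<delta> = (norm u)\<^sup>2 / 2"
          by (simp add: mem_sphere_iff_inner u_def \<delta>_def)
        have "u \<bullet> u \<in> \<rat>" unfolding inner_vec_def using u by (intro Rats_sum) auto
        then have rat: "(norm u)\<^sup>2 / 2 \<in> \<rat>" by (simp add: power2_norm_eq_inner)
        \<comment> \<open>The coordinates of \<open>u\<close> and the value of the relation are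
          rational, so \<open>\<sigma>\<close> carries the sphere equation into its
          conjugate.\<close>
        have "(\<Sum>i\<in>UNIV. complex_of_real (u $ i) * \<sigma> (complex_of_real (\<delta> $ i)))
            = (\<Sum>i\<in>UNIV. \<sigma> (complex_of_real (u $ i) * complex_of_real (\<delta> $ i)))"
          using u rat_K
          by (intro sum.cong refl) (simp add: rat_automorphism_mult[OF \<sigma> _ \<delta>K] rat_automorphism_Rats[OF \<sigma>])
        also have "\<dots> = \<sigma> (\<Sum>i\<in>UNIV. complex_of_real (u $ i) * complex_of_real (\<delta> $ i))"
          using u by (intro rat_automorphism_sum[OF K \<sigma>, symmetric] root_closed_ring_mult[OF K] \<delta>K rat_K)
        also have "\<dots> = \<sigma> (complex_of_real ((norm u)\<^sup>2 / 2))"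
          unfolding u\<delta>[symmetric] by (simp add: inner_vec_def)
        also have "\<dots> = complex_of_real ((norm u)\<^sup>2 / 2)"
          using rat by (intro rat_automorphism_Rats[OF \<sigma>]) (subst Rats_complex_of_real_iff)
        finally show "x \<in> ?T \<sigma>" unfolding mem_iff[OF \<sigma>] u_def .
      qed
    qed
  next
    show "(\<Inter>\<sigma>\<in>rat_automorphisms ?K. ?T \<sigma>) \<subseteq> closure (sphere \<gamma> r \<inter> rational_points)"
    proof
      fix x assume "x \<in> (\<Inter>\<sigma>\<in>rat_automorphisms ?K. ?T \<sigma>)"
      then have x: "(\<Sum>i\<in>UNIV. complex_of_real ((x - b) $ i) * \<sigma> (complex_of_real (\<delta> $ i)))
          = complex_of_real ((norm (x - b))\<^sup>2 / 2)" if "\<sigma> \<in> rat_automorphisms ?K" for \<sigma>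
        using mem_iff[OF that] that by blast
      have "x - b \<in> span (rational_value_vectors \<delta>)"
        using K \<delta>K x by (rule invariant_value_imp_span)
      \<comment> \<open>The identity automorphism recovers the equation of the sphere
        itself.\<close>
      moreover have "complex_of_real ((x - b) \<bullet> \<delta>) = complex_of_real ((norm (x - b))\<^sup>2 / 2)"
        unfolding x[OF identity_rat_automorphism[OF K], symmetric]
        using \<delta>K by (simp add: inner_vec_def)
      then have "(x - b) \<bullet> \<delta> = (norm (x - b))\<^sup>2 / 2" by (simp only: of_real_eq_iff)
      ultimately show "x \<in> closure (sphere \<gamma> r \<inter> rational_points)"
        using closure_rational_points_sphere[OF b, of "x - b" \<gamma>] unfolding r \<delta>_def by simp
    qed
  qed
qed

end
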